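(* Let $n$ be the maximum number of keys, $v \ge 1$ arbitrary the value length in bits, and suppose the key universe satisfies $|\mathcal{U}| \ge n^3$. Then any dynamic retrieval data structure (possibly randomized) requires an expected size of at least $$ nv + \Omega(n \log\log n) $$ bits (on some distribution over sequences of operations).
   Context: A retrieval data structure stores a set $K \subseteq \mathcal{U}$ of at most $n$ keys, each $k\in K$ associated with a $v$-bit value $f(k)$, and answers $\mathrm{Query}(k)$ with $f(k)$ if $k\in K$ and with an arbitrary output if $k\notin K$. A dynamic retrieval data structure supports queries, $\mathrm{Update}(k,f)$ (for $k\in K$, change the value of $k$ to $f$), $\mathrm{Insert}(k,f)$ (for $k\notin K$ with $|K|<n$, add $k$ to $K$ with value $f$), and $\mathrm{Delete}(k)$ (for $k\in K$, remove $k$ from $K$). The size is the number of bits of memory (the encoding of the data structure's state), measured in expectation. Logarithms are base 2. *)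

theory Defs
  imports "HOL-Probability.Probability"
begin

type_synonym bits = "bool list"
type_synonym tape = "nat \<Rightarrow> bool"

datatype operation =
    Query nat
  | Update nat bits
  | Insert nat bits
  | Delete nat

text \<open>The stored data is a partial map: its domain is the current key set and it sends
  every stored key to its value.\<close>

fun apply_op :: "(nat \<rightharpoonup> bits) \<Rightarrow> operation \<Rightarrow> (nat \<rightharpoonup> bits)" where
  "apply_op m (Query k) = m"
| "apply_op m (Update k f) = m(k \<mapsto> f)"
| "apply_op m (Insert k f) = m(k \<mapsto> f)"
| "apply_op m (Delete k) = m(k := None)"

fun admissible :: "nat set \<Rightarrow> nat \<Rightarrow> nat \<Rightarrow> (nat \<rightharpoonup> bits) \<Rightarrow> operation \<Rightarrow> bool" where
  "admissible U n v m (Query k) \<longleftrightarrow> k \<in> U"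
| "admissible U n v m (Update k f) \<longleftrightarrow> k \<in> dom m \<and> length f = v"
| "admissible U n v m (Insert k f) \<longleftrightarrow>
     k \<in> U \<and> k \<notin> dom m \<and> card (dom m) < n \<and> length f = v"
| "admissible U n v m (Delete k) \<longleftrightarrow> k \<in> dom m"

fun admissible_from :: "nat set \<Rightarrow> nat \<Rightarrow> nat \<Rightarrow> (nat \<rightharpoonup> bits) \<Rightarrow> operation list \<Rightarrow> bool" where
  "admissible_from U n v m [] \<longleftrightarrow> True"
| "admissible_from U n v m (x # xs) \<longleftrightarrow>
     admissible U n v m x \<and> admissible_from U n v (apply_op m x) xs"

definition op_sequences :: "nat set \<Rightarrow> nat \<Rightarrow> nat \<Rightarrow> operation list set" where
  "op_sequences U n v = {xs. admissible_from U n v Map.empty xs}"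

definition contents :: "operation list \<Rightarrow> (nat \<rightharpoonup> bits)" where
  "contents xs = foldl apply_op Map.empty xs"

text \<open>A state is the bit string held in memory. Randomness is a tape that every operation
  may read and that is not charged to the memory. The \<open>nat\<close> argument of \<open>step\<close> and
  \<open>answer\<close> is the number of operations performed before; it lets an operation use coins that
  are fresh at that time, so private coins as well as a persistent random seed are covered.
  Queries, like all other operations, may modify the state; \<open>answer\<close> is the output of a query
  asked in the given state.\<close>

record data_structure =
  initial :: "tape \<Rightarrow> bits"
  step :: "tape \<Rightarrow> nat \<Rightarrow> bits \<Rightarrow> operation \<Rightarrow> bits"
  answer :: "tape \<Rightarrow> nat \<Rightarrow> bits \<Rightarrow> nat \<Rightarrow> bits"

fun run_from :: "data_structure \<Rightarrow> tape \<Rightarrow> nat \<Rightarrow> bits \<Rightarrow> operation list \<Rightarrow> bits" where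
  "run_from D \<omega> t s [] = s"
| "run_from D \<omega> t s (x # xs) = run_from D \<omega> (Suc t) (step D \<omega> t s x) xs"

definition state_after :: "data_structure \<Rightarrow> tape \<Rightarrow> operation list \<Rightarrow> bits" where
  "state_after D \<omega> xs = run_from D \<omega> 0 (initial D \<omega>) xs"

text \<open>The measure \<open>M\<close> is the distribution of the tape; independent fair coins, or a point
  mass for a deterministic structure, are special cases. Queries for keys that are not stored
  are unconstrained.\<close>

definition dynamic_retrieval ::
    "nat set \<Rightarrow> nat \<Rightarrow> nat \<Rightarrow> tape measure \<Rightarrow> data_structure \<Rightarrow> bool" where
  "dynamic_retrieval U n v M D \<longleftrightarrow>
     prob_space M \<and>
     (\<forall>xs \<in> op_sequences U n v.
        (\<lambda>\<omega>. state_after D \<omega> xs) \<in> measurable M (count_space UNIV) \<and>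
        (\<forall>\<omega> \<in> space M. \<forall>k f. contents xs k = Some f \<longrightarrow>
           answer D \<omega> (length xs) (state_after D \<omega> xs) k = f))"

text \<open>Expectation over the operation sequence and the tape, drawn independently, of the
  length of the resulting state. It takes values in the extended nonnegative reals, so
  structures of infinite expected size need no special treatment.\<close>

definition expected_size ::
    "tape measure \<Rightarrow> data_structure \<Rightarrow> operation list pmf \<Rightarrow> ennreal" where
  "expected_size M D S =
     (\<integral>\<^sup>+ xs. (\<integral>\<^sup>+ \<omega>. ennreal (real (length (state_after D \<omega> xs))) \<partial>M) \<partial>measure_pmf S)"

end

theory Submission
  imports Defs "HOL-Real_Asymp.Real_Asymp"
begin

text \<open>
  Fix the random tape. Let \<open>m = n div 2\<close>, \<open>p = n - m\<close> and \<open>q = n\<^sup>2\<close>, and take \<open>p\<close> disjoint blocks of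
  \<open>q + 1\<close> keys, the last key of each block being called fixed. The operations insert a set \<open>A\<close> of
  one random key from each of the first \<open>m\<close> blocks together with the \<open>p\<close> fixed keys, then delete the
  fixed keys and insert a set \<open>B\<close> of one random key from each block; all values are random. The
  distribution stops after either phase with probability 1/2.

  If the sizes exceed \<open>n v\<close> by at most \<open>k\<close> bits, then a typical state \<open>s\<close> after the first phase is
  compatible with a fraction \<open>2\<^sup>-\<^sup>k\<close> of all sets \<open>A\<close>, so the possible keys \<open>W\<close> of \<open>A\<close> fill a
  fraction of about \<open>w = 2 powr - (k / m)\<close> of the blocks. About \<open>m w / 2\<close> keys of \<open>B\<close> lie in \<open>W\<close>
  and receive a new value. As the structure cannot tell which keys of \<open>W\<close> are in \<open>A\<close>, the state
  \<open>s'\<close> after the second phase has to answer like \<open>s\<close> on all of \<open>W\<close> except for a part that is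
  smaller by a factor of order \<open>n\<close>. Hence \<open>s\<close> and \<open>s'\<close> together locate those keys of \<open>B\<close>, at a
  cost of about \<open>m w log n\<close> bits. Thus \<open>k\<close> is at least of order \<open>m 2 powr - (k / m) log n\<close>, that
  is, of order \<open>n log log n\<close>.

  Everything is done by counting preimages of states, since the encodings are not prefix-free and
  the loss in passing from entropy to length may grow with \<open>v\<close>.
\<close>

section \<open>Counting\<close>

lemma markov_inequality_card:
  fixes f :: "'a \<Rightarrow> real"
  assumes "finite A" "\<And>x. x \<in> A \<Longrightarrow> 0 \<le> f x"
  shows "a * card {x \<in> A. a \<le> f x} \<le> sum f A"
proof -
  have "a * card {x \<in> A. a \<le> f x} = (\<Sum>x | x \<in> A \<and> a \<le> f x. a)"
    by simp
  also have "\<dots> \<le> (\<Sum>x | x \<in> A \<and> a \<le> f x. f x)"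
    by (intro sum_mono) auto
  also have "\<dots> \<le> sum f A"
    using assms by (intro sum_mono2) auto
  finally show ?thesis .
qed

lemma sum_card_le_by_columns:
  fixes b :: real
  assumes "finite A" "finite B" and "\<And>y. y \<in> B \<Longrightarrow> card {x \<in> A. R x y} \<le> b"
  shows "(\<Sum>x\<in>A. card {y \<in> B. R x y}) \<le> card B * b"
proof -
  have "(\<Sum>x\<in>A. card {y \<in> B. R x y}) = (\<Sum>y\<in>B. card {x \<in> A. R x y})"
    using assms by (intro sum_multicount_gen) auto
  also have "real \<dots> \<le> (\<Sum>y\<in>B. b)"
    unfolding of_nat_sum by (intro sum_mono assms)
  finally show ?thesis by simp
qed

lemma card_Sigma_le:
  fixes b :: real
  assumes "finite A" "\<And>x. x \<in> A \<Longrightarrow> finite (B x)" "\<And>x. x \<in> A \<Longrightarrow> card (B x) \<le> b"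
  shows "card (Sigma A B) \<le> card A * b"
proof -
  have "real (card (Sigma A B)) = (\<Sum>x\<in>A. real (card (B x)))"
    using assms by simp
  also have "\<dots> \<le> (\<Sum>x\<in>A. b)"
    by (intro sum_mono assms)
  finally show ?thesis by simp
qed

lemma card_le_by_fibres:
  assumes "finite A" "finite B"
    and le: "\<And>y. card {x \<in> A. f x = y} \<le> b * card {x \<in> B. f x = y}"
  shows "card A \<le> b * card B"
proof -
  have card_eq: "card C = (\<Sum>y\<in>f ` A \<union> f ` B. card {x \<in> C. f x = y})" if "C \<subseteq> A \<union> B" for C
  proof -
    have "finite C" "f ` C \<subseteq> f ` A \<union> f ` B"
      using that assms finite_subset[OF that] by auto
    then show ?thesis
      using sum.group[of C "f ` A \<union> f ` B" f "\<lambda>_. 1 :: nat"] assms(1,2)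
      by (simp only: card_eq_sum finite_imageI finite_UnI)
  qed
  have "card A = (\<Sum>y\<in>f ` A \<union> f ` B. card {x \<in> A. f x = y})"
    by (rule card_eq) simp
  also have "\<dots> \<le> (\<Sum>y\<in>f ` A \<union> f ` B. b * card {x \<in> B. f x = y})"
    by (intro sum_mono le)
  also have "\<dots> = b * card B"
    using card_eq[of B] by (simp add: sum_distrib_left)
  finally show ?thesis .
qed

lemma card_bool_lists_length_le: "card {s :: bool list. length s \<le> j} \<le> 2 ^ (j + 1)"
proof -
  have "card {s :: bool list. length s \<le> j} = (\<Sum>i\<le>j. 2 ^ i)"
    using card_lists_length_le[of "UNIV :: bool set" j] by simp
  also have "\<dots> \<le> 2 ^ (j + 1)"
    by (induction j) auto
  finally show ?thesis .
qed

lemma card_short_codes_le: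
  fixes f :: "'a \<Rightarrow> bool list" and b :: real
  assumes "finite A" and le: "\<And>s. card {x \<in> A. f x = s} \<le> b"
  shows "card {x \<in> A. length (f x) \<le> j} \<le> 2 ^ (j + 1) * b"
proof -
  let ?L = "{s :: bool list. length s \<le> j}"
  have fin: "finite ?L"
    using finite_lists_length_le[of "UNIV :: bool set" j] by simp
  have "0 \<le> b"
    using le[of "[]"] of_nat_0_le_iff order_trans by blast
  have "card {x \<in> A. length (f x) \<le> j} \<le> card (SIGMA s : ?L. {x \<in> A. f x = s})"
    using fin \<open>finite A\<close>
    by (intro card_inj_on_le[of "\<lambda>x. (f x, x)"]) (auto simp: inj_on_def)
  also have "real \<dots> \<le> card ?L * b"
    using fin \<open>finite A\<close> le by (intro card_Sigma_le) auto
  also have "\<dots> \<le> 2 ^ (j + 1) * b"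
    using of_nat_mono[OF card_bool_lists_length_le[of j], where ?'a = real] \<open>0 \<le> b\<close>
    by (intro mult_right_mono) simp_all
  finally show ?thesis by simp
qed

lemma card_short_rare_codes_le:
  fixes f :: "'a \<Rightarrow> bool list" and b :: real
  assumes "finite A" "0 \<le> b"
  shows "card {x \<in> A. length (f x) \<le> j \<and> card {y \<in> A. f y = f x} \<le> b} \<le> 2 ^ (j + 1) * b"
proof -
  let ?R = "{x \<in> A. card {y \<in> A. f y = f x} \<le> b}"
  have "card {x \<in> ?R. f x = s} \<le> b" for s
  proof (cases "card {y \<in> A. f y = s} \<le> b")
    case True
    have "card {x \<in> ?R. f x = s} \<le> card {y \<in> A. f y = s}"
      using \<open>finite A\<close> by (intro card_mono) auto
    with True show ?thesis by linarith
  next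
    case False
    then have empty: "{x \<in> ?R. f x = s} = {}" by auto
    show ?thesis unfolding empty using \<open>0 \<le> b\<close> by simp
  qed
  then have "card {x \<in> ?R. length (f x) \<le> j} \<le> 2 ^ (j + 1) * b"
    using \<open>finite A\<close> by (intro card_short_codes_le) auto
  then show ?thesis
    by (simp add: conj_ac cong: conj_cong)
qed

lemma sum_code_deficit_le:
  fixes f :: "'a \<Rightarrow> bool list" and b :: real
  assumes "finite A" and le: "\<And>s. card {x \<in> A. f x = s} \<le> b"
  shows "(\<Sum>x\<in>A. N - length (f x)) \<le> 2 * 2 ^ N * b"
proof -
  have deficit: "N - length (f x) = card {j \<in> {..<N}. length (f x) \<le> j}" for x
  proof -
    have "{j \<in> {..<N}. length (f x) \<le> j} = {length (f x)..<N}" by auto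
    then show ?thesis by simp
  qed
  have "0 \<le> b"
    using le[of "[]"] of_nat_0_le_iff order_trans by blast
  have "(\<Sum>x\<in>A. N - length (f x)) = (\<Sum>j<N. card {x \<in> A. length (f x) \<le> j})"
    unfolding deficit using \<open>finite A\<close> by (intro sum_multicount_gen) auto
  also have "real \<dots> \<le> (\<Sum>j<N. 2 ^ (j + 1) * b)"
    unfolding of_nat_sum by (intro sum_mono card_short_codes_le assms)
  also have "\<dots> \<le> 2 * 2 ^ N * b"
    using \<open>0 \<le> b\<close> by (induction N) (auto simp: mult_ac)
  finally show ?thesis .
qed

text \<open>The codes need not be prefix-free, so the length of \<open>f x\<close> can average slightly less than the
  entropy. The last summand accounts for this, at a constant cost per element of \<open>A\<close> when \<open>b\<close> is of
  order \<open>card A / 2 ^ N\<close>.\<close>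

lemma card_long_codes_le:
  fixes f :: "'a \<Rightarrow> bool list" and b :: real
  assumes "finite A" "\<And>s. card {x \<in> A. f x = s} \<le> b"
  shows "real k * card {x \<in> A. N + k < length (f x)}
    \<le> (\<Sum>x\<in>A. real (length (f x)) - real N) + 2 * 2 ^ N * b"
proof -
  have "real k * card {x \<in> A. N + k < length (f x)}
      \<le> real k * card {x \<in> A. real k \<le> real (length (f x) - N)}"
    using \<open>finite A\<close> by (intro mult_left_mono of_nat_mono card_mono) auto
  also have "\<dots> \<le> (\<Sum>x\<in>A. real (length (f x) - N))"
    using \<open>finite A\<close> by (intro markov_inequality_card) auto
  also have "\<dots> = (\<Sum>x\<in>A. (real (length (f x)) - real N) + real (N - length (f x)))"
    by (intro sum.cong refl) linarith
  also have "\<dots> \<le> (\<Sum>x\<in>A. real (length (f x)) - real N) + 2 * 2 ^ N * b"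
    using sum_code_deficit_le[OF assms, of N] by (simp add: sum.distrib)
  finally show ?thesis .
qed

lemma sum_power_card_PiE_le:
  fixes t :: real
  assumes I: "finite I" and J: "J \<subseteq> I" and X: "\<And>i. i \<in> I \<Longrightarrow> finite (X i)" and t: "0 \<le> t"
  shows "(\<Sum>c\<in>PiE I X. t ^ card {i \<in> J. P i (c i)})
    \<le> card (PiE I X) * exp ((t - 1) * (\<Sum>i\<in>J. card {x \<in> X i. P i x} / card (X i)))"
proof -
  let ?w = "\<lambda>i x. if i \<in> J \<and> P i x then t else 1"
  let ?e = "\<lambda>i. if i \<in> J then (t - 1) * (card {x \<in> X i. P i x} / card (X i)) else 0"
  have "{i \<in> I. i \<in> J \<and> P i (c i)} = {i \<in> J. P i (c i)}" for c
    using J by auto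
  then have "(\<Sum>c\<in>PiE I X. t ^ card {i \<in> J. P i (c i)}) = (\<Sum>c\<in>PiE I X. \<Prod>i\<in>I. ?w i (c i))"
    using I by (simp add: prod.If_cases Int_def)
  also have "\<dots> = (\<Prod>i\<in>I. \<Sum>x\<in>X i. ?w i x)"
    using I X by (intro prod_sum_PiE [symmetric]) auto
  also have "\<dots> \<le> (\<Prod>i\<in>I. card (X i) * exp (?e i))"
  proof (intro prod_mono conjI)
    fix i assume i: "i \<in> I"
    show "0 \<le> (\<Sum>x\<in>X i. ?w i x)"
      using t by (intro sum_nonneg) auto
    have "(\<Sum>x\<in>X i. ?w i x) = (\<Sum>x\<in>X i. 1 + (if i \<in> J \<and> P i x then t - 1 else 0))"
      by (intro sum.cong) auto
    also have "\<dots> = card (X i) * (1 + ?e i)"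
    proof -
      have "real (card {x \<in> X i. P i x}) = card (X i) * (card {x \<in> X i. P i x} / card (X i))"
        using X[OF i] by (cases "X i = {}") auto
      then show ?thesis
        using X[OF i]
        by (auto simp: sum.distrib sum.If_cases Int_def distrib_left mult.left_commute)
    qed
    also have "\<dots> \<le> card (X i) * exp (?e i)"
      by (intro mult_left_mono exp_ge_add_one_self) auto
    finally show "(\<Sum>x\<in>X i. ?w i x) \<le> card (X i) * exp (?e i)" .
  qed
  also have "\<dots> = card (PiE I X) * exp (\<Sum>i\<in>I. ?e i)"
    using I by (simp add: prod.distrib exp_sum card_PiE)
  also have "(\<Sum>i\<in>I. ?e i) = (t - 1) * (\<Sum>i\<in>J. card {x \<in> X i. P i x} / card (X i))"
    using I J by (simp add: sum.If_cases Int_absorb1 sum_distrib_left)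
  finally show ?thesis .
qed

lemma card_PiE_power_ge_le:
  fixes a t :: real
  assumes "finite I" "J \<subseteq> I" "\<And>i. i \<in> I \<Longrightarrow> finite (X i)" "0 \<le> t"
  shows "a * card {c \<in> PiE I X. a \<le> t ^ card {i \<in> J. P i (c i)}}
    \<le> card (PiE I X) * exp ((t - 1) * (\<Sum>i\<in>J. card {x \<in> X i. P i x} / card (X i)))"
proof -
  have "a * card {c \<in> PiE I X. a \<le> t ^ card {i \<in> J. P i (c i)}}
      \<le> (\<Sum>c\<in>PiE I X. t ^ card {i \<in> J. P i (c i)})"
    using assms by (intro markov_inequality_card finite_PiE) auto
  also have "\<dots> \<le> card (PiE I X) * exp ((t - 1) * (\<Sum>i\<in>J. card {x \<in> X i. P i x} / card (X i)))"
    using assms by (intro sum_power_card_PiE_le)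
  finally show ?thesis .
qed

lemma card_PiE_upper_tail_le:
  fixes t :: real
  assumes "finite I" "J \<subseteq> I" "\<And>i. i \<in> I \<Longrightarrow> finite (X i)" "1 \<le> t"
  shows "t ^ h * card {c \<in> PiE I X. h \<le> card {i \<in> J. P i (c i)}}
    \<le> card (PiE I X) * exp ((t - 1) * (\<Sum>i\<in>J. card {x \<in> X i. P i x} / card (X i)))"
proof -
  have "t ^ h * card {c \<in> PiE I X. h \<le> card {i \<in> J. P i (c i)}}
      \<le> t ^ h * card {c \<in> PiE I X. t ^ h \<le> t ^ card {i \<in> J. P i (c i)}}"
    using assms finite_PiE[of I X]
    by (intro mult_left_mono of_nat_mono card_mono) (auto intro: power_increasing)
  also have "\<dots> \<le> card (PiE I X) * exp ((t - 1) * (\<Sum>i\<in>J. card {x \<in> X i. P i x} / card (X i)))"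
    using assms by (intro card_PiE_power_ge_le) auto
  finally show ?thesis .
qed

lemma card_PiE_lower_tail_le:
  fixes t :: real
  assumes "finite I" "J \<subseteq> I" "\<And>i. i \<in> I \<Longrightarrow> finite (X i)" "0 \<le> t" "t \<le> 1"
  shows "t ^ h * card {c \<in> PiE I X. card {i \<in> J. P i (c i)} \<le> h}
    \<le> card (PiE I X) * exp ((t - 1) * (\<Sum>i\<in>J. card {x \<in> X i. P i x} / card (X i)))"
proof -
  have "t ^ h * card {c \<in> PiE I X. card {i \<in> J. P i (c i)} \<le> h}
      \<le> t ^ h * card {c \<in> PiE I X. t ^ h \<le> t ^ card {i \<in> J. P i (c i)}}"
    using assms finite_PiE[of I X]
    by (intro mult_left_mono of_nat_mono card_mono) (auto intro: power_decreasing)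
  also have "\<dots> \<le> card (PiE I X) * exp ((t - 1) * (\<Sum>i\<in>J. card {x \<in> X i. P i x} / card (X i)))"
    using assms by (intro card_PiE_power_ge_le) auto
  finally show ?thesis .
qed

lemma card_PiE_component:
  assumes I: "finite I" and i: "i \<in> I" and Y: "Y \<subseteq> X i"
  shows "card {c \<in> PiE I X. c i \<in> Y} * card (X i) = card Y * card (PiE I X)"
proof -
  have "c \<in> {c \<in> PiE I X. c i \<in> Y} \<longleftrightarrow> c \<in> PiE I (X(i := Y))" for c
    using i Y unfolding PiE_iff mem_Collect_eq by (metis fun_upd_apply subsetD)
  then have "card {c \<in> PiE I X. c i \<in> Y} = (\<Prod>j\<in>I. card ((X(i := Y)) j))"
    using I by (subst card_PiE[symmetric]) (auto intro!: arg_cong[where f = card])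
  also have "\<dots> = card Y * (\<Prod>j\<in>I - {i}. card (X j))"
    using I i by (subst prod.remove[of _ i]) (auto intro!: prod.cong)
  finally show ?thesis
    using I i by (simp add: card_PiE prod.remove[of I i])
qed

section \<open>Parameters\<close>

lemma power_two_exp_le:
  fixes \<mu> :: real
  assumes "8 * real h \<le> \<mu>" "40 \<le> \<mu>"
  shows "2 ^ h * exp (- \<mu> / 4) \<le> 1 / 32"
proof -
  have exp_1_ge: "(2::real) \<le> exp 1"
    using exp_ge_add_one_self[of 1] by simp
  then have "2 ^ h \<le> exp (real h)"
    using power_mono[OF exp_1_ge, of h] by (simp flip: exp_of_nat_mult)
  then have "2 ^ h * exp (- \<mu> / 4) \<le> exp (real h) * exp (- \<mu> / 4)"
    by (rule mult_right_mono) simp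
  also have "\<dots> \<le> exp (- 5)"
    using assms unfolding exp_add[symmetric] by simp
  also have "\<dots> \<le> 1 / 32"
    using power_mono[OF exp_1_ge, of 5] by (simp add: exp_minus field_simps flip: exp_of_nat_mult)
  finally show ?thesis .
qed

text \<open>If a state leaves \<open>q\<^sup>m / 2\<^sup>r\<close> possibilities for \<open>m\<close> keys from blocks of size \<open>q\<close>, then a
  random choice of one key per block hits on average at least \<open>overlap m r\<close> possible keys.\<close>

definition overlap :: "nat \<Rightarrow> nat \<Rightarrow> real" where
  "overlap m r = m * 2 powr (- (r / m))"

text \<open>With an average excess of \<open>R\<close> bits, most states have an excess of at most \<open>k\<close>. The second
  phase then typically changes the values of more than \<open>h\<close> possible keys, which by an exponential
  moment with parameter \<open>t\<close> requires \<open>t ^ h\<close> to be at most \<open>2 ^ (k + 4) * exp (8 * t)\<close>.\<close>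

definition forces_excess :: "nat \<Rightarrow> real \<Rightarrow> bool" where
  "forces_excess m R \<longleftrightarrow> 0 \<le> R \<and> (\<exists>k h. \<exists>t::real. 8 * R + 20 \<le> real k \<and>
     8 * real h \<le> overlap m (k + 4) \<and> 40 \<le> overlap m (k + 4) \<and>
     1 \<le> t \<and> 2 ^ (k + 4) * exp (8 * t) < t ^ h)"

lemma eventually_forces_excess:
  "\<forall>\<^sub>F n in sequentially. forces_excess (n div 2) (1 / 64 * (n * log 2 (log 2 n)))"
proof -
  define R where "R n = 1 / 64 * (real n * log 2 (log 2 n))" for n :: nat
  define k where "k n = nat \<lceil>8 * R n + 20\<rceil>" for n
  define h where "h n = nat \<lfloor>n / (8 * sqrt (log 2 n))\<rfloor>" for n :: nat
  have "\<forall>\<^sub>F n in sequentially. 0 \<le> R n"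
    unfolding R_def by real_asymp
  moreover have "\<forall>\<^sub>F n in sequentially. 8 * real (h n) \<le> overlap (n div 2) (k n + 4)"
    unfolding overlap_def h_def k_def R_def by real_asymp
  moreover have "\<forall>\<^sub>F n in sequentially. 40 \<le> overlap (n div 2) (k n + 4)"
    unfolding overlap_def k_def R_def by real_asymp
  moreover have "\<forall>\<^sub>F n in sequentially. 1 \<le> sqrt n"
    by real_asymp
  moreover have "\<forall>\<^sub>F n in sequentially. 2 ^ (k n + 4) * exp (8 * sqrt n) < sqrt n ^ h n"
    unfolding h_def k_def R_def by real_asymp
  ultimately show ?thesis
  proof eventually_elim
    case (elim n)
    have "8 * R n + 20 \<le> k n"
      unfolding k_def by (rule real_nat_ceiling_ge)
    with elim show ?case
      unfolding forces_excess_def R_def by blast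
  qed
qed

section \<open>Assignments of keys and values to blocks\<close>

definition bitstrings :: "nat \<Rightarrow> bits set" where
  "bitstrings v = {f. length f = v}"

lemma finite_bitstrings [simp]: "finite (bitstrings v)"
  using finite_lists_length_eq[of "UNIV :: bool set" v] by (simp add: bitstrings_def)

lemma card_bitstrings [simp]: "card (bitstrings v) = 2 ^ v"
  using card_lists_length_eq[of "UNIV :: bool set" v] by (simp add: bitstrings_def)

text \<open>An assignment \<open>d\<close> picks in each block \<open>i\<close> the key with index \<open>fst (d i)\<close> and gives it the
  value \<open>snd (d i)\<close>. The data of the first phase also comprise the values of the fixed keys.\<close>

type_synonym assignment = "nat \<Rightarrow> nat \<times> bits"
type_synonym stored_data = "assignment \<times> (nat \<Rightarrow> bits)"

definition assignments :: "nat \<Rightarrow> nat \<Rightarrow> nat \<Rightarrow> assignment set" where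
  "assignments k q v = PiE {..<k} (\<lambda>_. {..<q} \<times> bitstrings v)"

lemma finite_assignments [simp]: "finite (assignments k q v)"
  by (simp add: assignments_def finite_PiE)

lemma card_assignments: "card (assignments k q v) = q ^ k * 2 ^ (k * v)"
  by (simp add: assignments_def card_cartesian_product card_PiE power_mult_distrib
      mult.commute[of _ v] flip: power_mult)

lemma assignmentsD:
  assumes "d \<in> assignments k q v" "i < k"
  shows "fst (d i) < q" "snd (d i) \<in> bitstrings v"
  using assms by (auto simp: assignments_def PiE_iff mem_Times_iff)

definition collide :: "nat \<Rightarrow> assignment \<Rightarrow> assignment \<Rightarrow> bool" where
  "collide m d c \<longleftrightarrow> (\<exists>i<m. fst (d i) = fst (c i))"

lemma card_same_key_le:
  assumes "i < k" "0 < q"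
  shows "card {c \<in> assignments k q v. fst (c i) = x} \<le> card (assignments k q v) / q"
proof -
  let ?Y = "({x} \<inter> {..<q}) \<times> bitstrings v"
  have "{c \<in> assignments k q v. fst (c i) = x} = {c \<in> assignments k q v. c i \<in> ?Y}"
    using assignmentsD[OF _ \<open>i < k\<close>] by (auto simp: mem_Times_iff)
  then have "card {c \<in> assignments k q v. fst (c i) = x} * (q * 2 ^ v)
      = card ({x} \<inter> {..<q}) * 2 ^ v * card (assignments k q v)"
    using card_PiE_component[of "{..<k}" i ?Y "\<lambda>_. {..<q} \<times> bitstrings v"] \<open>i < k\<close>
    by (auto simp: assignments_def card_cartesian_product)
  also have "\<dots> \<le> 1 * 2 ^ v * card (assignments k q v)"
    using card_mono[of "{x}" "{x} \<inter> {..<q}"] by (intro mult_right_mono) auto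
  finally have "card {c \<in> assignments k q v. fst (c i) = x} * q \<le> card (assignments k q v)"
    by simp
  then show ?thesis
    using \<open>0 < q\<close> by (simp add: pos_le_divide_eq flip: of_nat_mult)
qed

lemma card_collide_le:
  assumes "m \<le> k" "0 < q"
  shows "card {c \<in> assignments k q v. collide m d c} \<le> m / q * card (assignments k q v)"
proof -
  have "card {c \<in> assignments k q v. collide m d c}
      \<le> card (\<Union>i<m. {c \<in> assignments k q v. fst (c i) = fst (d i)})"
    by (intro card_mono) (auto simp: collide_def)
  also have "\<dots> \<le> (\<Sum>i<m. card {c \<in> assignments k q v. fst (c i) = fst (d i)})"
    by (rule card_UN_le) simp
  also have "real \<dots> \<le> (\<Sum>i<m. card (assignments k q v) / q)"
    unfolding of_nat_sum using assms by (intro sum_mono card_same_key_le) auto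
  finally show ?thesis by simp
qed

definition answered_assignments ::
    "nat \<Rightarrow> (nat \<Rightarrow> nat set) \<Rightarrow> (nat \<Rightarrow> nat \<Rightarrow> bits) \<Rightarrow> assignment set" where
  "answered_assignments k X ans = PiE {..<k} (\<lambda>i. SIGMA x : X i. {ans i x})"

lemma finite_answered_assignments [simp]:
  "(\<And>i. i < k \<Longrightarrow> finite (X i)) \<Longrightarrow> finite (answered_assignments k X ans)"
  by (auto simp: answered_assignments_def intro!: finite_PiE)

lemma card_answered_assignments:
  "(\<And>i. i < k \<Longrightarrow> finite (X i)) \<Longrightarrow> card (answered_assignments k X ans) = (\<Prod>i<k. card (X i))"
  by (simp add: answered_assignments_def card_PiE)

lemma answered_assignmentsI:
  assumes "d \<in> assignments k q v"
    and "\<And>i. i < k \<Longrightarrow> fst (d i) \<in> X i" "\<And>i. i < k \<Longrightarrow> ans i (fst (d i)) = snd (d i)"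
  shows "d \<in> answered_assignments k X ans"
  unfolding answered_assignments_def
proof (rule PiE_I)
  fix i assume "i \<in> {..<k}"
  then have "(fst (d i), snd (d i)) \<in> (SIGMA x : X i. {ans i x})"
    using assms(2,3) by (intro SigmaI) auto
  then show "d i \<in> (SIGMA x : X i. {ans i x})" by (simp only: prod.collapse)
qed (use assms(1) in \<open>auto simp: assignments_def\<close>)

section \<open>Two phases with a fixed tape\<close>

definition first_phase :: "nat \<Rightarrow> nat \<Rightarrow> nat \<Rightarrow> nat \<Rightarrow> stored_data set" where
  "first_phase m p q v = assignments m q v \<times> PiE {..<p} (\<lambda>_. bitstrings v)"

definition both_phases ::
    "nat \<Rightarrow> nat \<Rightarrow> nat \<Rightarrow> nat \<Rightarrow> (stored_data \<times> assignment) set" where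
  "both_phases m p q v =
    (SIGMA \<omega> : first_phase m p q v. {c \<in> assignments p q v. \<not> collide m (fst \<omega>) c})"

lemma finite_first_phase [simp]: "finite (first_phase m p q v)"
  by (simp add: first_phase_def finite_PiE)

lemma finite_both_phases [simp]: "finite (both_phases m p q v)"
  by (simp add: both_phases_def)

lemma card_first_phase: "card (first_phase m p q v) = q ^ m * 2 ^ ((m + p) * v)"
  by (simp add: first_phase_def card_cartesian_product card_assignments card_PiE
      mult.commute[of _ v] distrib_left power_add flip: power_mult)

lemma card_both_phases_ge:
  assumes "m \<le> p" "0 < q"
  shows "(1 - m / q) * (real (card (first_phase m p q v)) * real (card (assignments p q v)))
    \<le> card (both_phases m p q v)"
proof -
  let ?\<Omega> = "first_phase m p q v \<times> assignments p q v"
  let ?C = "SIGMA \<omega> : first_phase m p q v. {c \<in> assignments p q v. collide m (fst \<omega>) c}"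
  have product_eq: "?\<Omega> = both_phases m p q v \<union> ?C"
    by (auto simp: both_phases_def)
  have "card ?\<Omega> = card (both_phases m p q v) + card ?C"
    unfolding product_eq by (rule card_Un_disjoint) (auto simp: both_phases_def)
  then have card_eq: "real (card (first_phase m p q v)) * real (card (assignments p q v))
      = real (card (both_phases m p q v)) + real (card ?C)"
    by (simp only: card_cartesian_product flip: of_nat_mult of_nat_add)
  have "card ?C \<le> card (first_phase m p q v) * (m / q * card (assignments p q v))"
    using assms by (intro card_Sigma_le card_collide_le) auto
  also have "\<dots> = m / q * (real (card (first_phase m p q v)) * real (card (assignments p q v)))"
    by (simp only: mult_ac)
  finally show ?thesis
    unfolding left_diff_distrib using card_eq by linarith
qed

locale phase_sizes =
  fixes m p q v :: nat
  assumes m_ge: "16 \<le> m" and m_le: "m \<le> p" and q_ge: "4 * m\<^sup>2 \<le> q" and v_pos: "0 < v"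
begin

abbreviation "\<Omega>\<^sub>1 \<equiv> first_phase m p q v"
abbreviation "\<Omega>\<^sub>2 \<equiv> assignments p q v"
abbreviation "\<Omega> \<equiv> both_phases m p q v"
abbreviation "N \<equiv> (m + p) * v"

lemma q_pos: "0 < q"
proof -
  have "0 < 4 * m\<^sup>2" using m_ge by simp
  then show ?thesis using q_ge by linarith
qed

lemma m_div_q_le: "m / q \<le> 1 / 64"
proof -
  have "64 * m \<le> 4 * m\<^sup>2"
    using m_ge by (simp add: power2_eq_square)
  then have "64 * m \<le> q" using q_ge by simp
  then have "64 * real m \<le> q" by (simp flip: of_nat_le_iff)
  then show ?thesis
    using q_pos by (simp add: divide_simps)
qed

abbreviation "num_pairs \<equiv> real (card \<Omega>\<^sub>1) * real (card \<Omega>\<^sub>2)"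

lemma num_pairs_eq: "num_pairs = real q ^ m * 2 ^ N * (real q ^ p * 2 ^ (p * v))"
  by (simp add: card_first_phase card_assignments)

lemma num_pairs_pos: "0 < num_pairs"
  unfolding num_pairs_eq using q_pos by simp

lemma num_pairs_le_card_both_phases: "63 / 64 * num_pairs \<le> card \<Omega>"
proof -
  have "63 / 64 * num_pairs \<le> (1 - m / q) * num_pairs"
    using m_div_q_le by (intro mult_right_mono) auto
  also have "\<dots> \<le> card \<Omega>"
    using m_le q_pos by (rule card_both_phases_ge)
  finally show ?thesis .
qed

lemma card_both_phases_pos: "0 < card \<Omega>"
proof -
  have "0 < real (card \<Omega>)"
    using num_pairs_le_card_both_phases num_pairs_pos by linarith
  then show ?thesis by simp
qed

lemma both_phases_nonempty: "\<Omega> \<noteq> {}"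
  using card_both_phases_pos by auto

end

text \<open>Here \<open>enc (d, \<gamma>)\<close> is the state after storing \<open>d\<close> and the values \<open>\<gamma>\<close> of the fixed keys, and
  \<open>upd s c\<close> is the state reached from \<open>s\<close> by replacing the fixed keys by \<open>c\<close>. In these states the
  key with index \<open>x\<close> of block \<open>i\<close> is answered by \<open>ans1\<close> and \<open>ans2\<close>; the fixed key of a block has
  index \<open>q\<close>.\<close>

locale two_phase = phase_sizes +
  fixes enc :: "stored_data \<Rightarrow> bits"
    and upd :: "bits \<Rightarrow> assignment \<Rightarrow> bits"
    and ans1 ans2 :: "bits \<Rightarrow> nat \<Rightarrow> nat \<Rightarrow> bits"
  assumes ans1_old: "\<And>d \<gamma> i. (d, \<gamma>) \<in> \<Omega>\<^sub>1 \<Longrightarrow> i < m \<Longrightarrow> ans1 (enc (d, \<gamma>)) i (fst (d i)) = snd (d i)"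
    and ans1_fixed: "\<And>d \<gamma> j. (d, \<gamma>) \<in> \<Omega>\<^sub>1 \<Longrightarrow> j < p \<Longrightarrow> ans1 (enc (d, \<gamma>)) j q = \<gamma> j"
    and ans2_old: "\<And>d \<gamma> c i. ((d, \<gamma>), c) \<in> \<Omega> \<Longrightarrow> i < m \<Longrightarrow>
      ans2 (upd (enc (d, \<gamma>)) c) i (fst (d i)) = snd (d i)"
    and ans2_new: "\<And>d \<gamma> c i. ((d, \<gamma>), c) \<in> \<Omega> \<Longrightarrow> i < p \<Longrightarrow>
      ans2 (upd (enc (d, \<gamma>)) c) i (fst (c i)) = snd (c i)"
begin

abbreviation "enc2 \<tau> \<equiv> upd (enc (fst \<tau>)) (snd \<tau>)"

definition encoded_by :: "bits \<Rightarrow> stored_data set" where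
  "encoded_by s = {\<omega> \<in> \<Omega>\<^sub>1. enc \<omega> = s}"

definition possible_keys :: "bits \<Rightarrow> nat \<Rightarrow> nat set" where
  "possible_keys s i = (\<lambda>\<omega>. fst (fst \<omega> i)) ` encoded_by s"

definition changed :: "bits \<Rightarrow> nat \<Rightarrow> nat \<times> bits \<Rightarrow> bool" where
  "changed s i z \<longleftrightarrow> fst z \<in> possible_keys s i \<and> snd z \<noteq> ans1 s i (fst z)"

definition altered :: "bits \<Rightarrow> bits \<Rightarrow> (nat \<times> nat) set" where
  "altered s s' = (SIGMA i : {..<m}. {x. changed s i (x, ans2 s' i x)})"

definition changed_blocks :: "bits \<Rightarrow> assignment \<Rightarrow> nat set" where
  "changed_blocks s c = {i \<in> {..<m}. changed s i (c i)}"

definition colliding :: "bits \<Rightarrow> assignment \<Rightarrow> stored_data set" where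
  "colliding s c = {\<omega> \<in> encoded_by s. collide m (fst \<omega>) c}"

lemma finite_encoded_by [simp]: "finite (encoded_by s)"
  by (simp add: encoded_by_def)

lemma finite_possible_keys [simp]: "finite (possible_keys s i)"
  by (simp add: possible_keys_def)

lemma possible_keys_subset: "i < m \<Longrightarrow> possible_keys s i \<subseteq> {..<q}"
  by (auto simp: possible_keys_def encoded_by_def first_phase_def dest: assignmentsD)

subsection \<open>The states determine the assignments up to their keys\<close>

lemma card_encoded_by_le: "card (encoded_by s) \<le> (\<Prod>i<m. card (possible_keys s i))"
proof -
  have "encoded_by s
      \<subseteq> answered_assignments m (possible_keys s) (ans1 s) \<times> {restrict (\<lambda>j. ans1 s j q) {..<p}}"
  proof (rule subrelI)
    fix d \<gamma> assume "(d, \<gamma>) \<in> encoded_by s"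
    then have \<omega>: "(d, \<gamma>) \<in> \<Omega>\<^sub>1" "enc (d, \<gamma>) = s" and keys: "\<And>i. fst (d i) \<in> possible_keys s i"
      by (force simp: encoded_by_def possible_keys_def)+
    have "d \<in> answered_assignments m (possible_keys s) (ans1 s)"
      using \<omega> keys ans1_old[OF \<omega>(1)] by (intro answered_assignmentsI) (auto simp: first_phase_def)
    moreover have "\<gamma> = restrict (\<lambda>j. ans1 s j q) {..<p}"
      using \<omega> ans1_fixed[OF \<omega>(1)] by (auto simp: first_phase_def PiE_iff extensional_def)
    ultimately show "(d, \<gamma>) \<in> answered_assignments m (possible_keys s) (ans1 s)
        \<times> {restrict (\<lambda>j. ans1 s j q) {..<p}}"
      by simp
  qed
  then have "card (encoded_by s) \<le> card (answered_assignments m (possible_keys s) (ans1 s)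
      \<times> {restrict (\<lambda>j. ans1 s j q) {..<p}})"
    by (intro card_mono) auto
  then show ?thesis
    by (simp add: card_cartesian_product card_answered_assignments)
qed

lemma card_encoded_by_le_power: "card (encoded_by s) \<le> q ^ m"
proof -
  have "(\<Prod>i<m. card (possible_keys s i)) \<le> (\<Prod>i<m. q)"
    using card_mono[OF _ possible_keys_subset] by (intro prod_mono) auto
  then show ?thesis
    using card_encoded_by_le[of s] by simp
qed

abbreviation "compatible_old s' \<equiv>
  answered_assignments m (\<lambda>_. {..<q}) (ans2 s') \<times> PiE {..<p} (\<lambda>_. bitstrings v)"

abbreviation "compatible_new s' \<equiv> answered_assignments p (\<lambda>_. {..<q}) (ans2 s')"

lemma finite_compatible_old: "finite (compatible_old s')"
  by (auto intro!: finite_PiE)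

lemma card_compatible_old: "card (compatible_old s') = q ^ m * 2 ^ (p * v)"
  by (simp add: card_cartesian_product card_answered_assignments card_PiE mult.commute[of _ v]
      flip: power_mult)

lemma card_compatible_new: "card (compatible_new s') = q ^ p"
  by (simp add: card_answered_assignments)

lemma old_compatible:
  assumes "(\<omega>, c) \<in> \<Omega>"
  shows "\<omega> \<in> compatible_old (upd (enc \<omega>) c)"
proof (cases \<omega>)
  case (Pair d \<gamma>)
  have "d \<in> assignments m q v" "\<gamma> \<in> PiE {..<p} (\<lambda>_. bitstrings v)"
    using assms Pair by (auto simp: both_phases_def first_phase_def)
  moreover from this have "d \<in> answered_assignments m (\<lambda>_. {..<q}) (ans2 (upd (enc \<omega>) c))"
    using ans2_old[of d \<gamma> c] assms Pair by (intro answered_assignmentsI) (auto dest: assignmentsD)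
  ultimately show ?thesis using Pair by simp
qed

lemma new_compatible:
  assumes "(\<omega>, c) \<in> \<Omega>"
  shows "c \<in> compatible_new (upd (enc \<omega>) c)"
proof -
  have "c \<in> assignments p q v"
    using assms by (simp add: both_phases_def)
  then show ?thesis
    using ans2_new[of "fst \<omega>" "snd \<omega>" c] assms
    by (intro answered_assignmentsI) (auto dest: assignmentsD)
qed

lemma card_enc_fibre_le: "card {\<tau> \<in> \<Omega>. enc (fst \<tau>) = s} \<le> num_pairs / 2 ^ N"
proof -
  have "card {\<tau> \<in> \<Omega>. enc (fst \<tau>) = s} \<le> card (encoded_by s \<times> \<Omega>\<^sub>2)"
    by (intro card_mono) (auto simp: both_phases_def encoded_by_def)
  also have "\<dots> \<le> q ^ m * card \<Omega>\<^sub>2"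
    using card_encoded_by_le_power by (simp add: card_cartesian_product)
  also have "real \<dots> = num_pairs / 2 ^ N"
    by (simp add: card_first_phase)
  finally show ?thesis by simp
qed

lemma card_enc2_fibre_le: "card {\<tau> \<in> \<Omega>. enc2 \<tau> = s'} \<le> num_pairs / 2 ^ N"
proof -
  have "{\<tau> \<in> \<Omega>. enc2 \<tau> = s'} \<subseteq> compatible_old s' \<times> compatible_new s'"
    using old_compatible new_compatible by fastforce
  then have "card {\<tau> \<in> \<Omega>. enc2 \<tau> = s'} \<le> card (compatible_old s' \<times> compatible_new s')"
    using finite_compatible_old by (intro card_mono) auto
  also have "\<dots> = q ^ m * 2 ^ (p * v) * q ^ p"
    unfolding card_cartesian_product[of "compatible_old s'"]
    by (simp only: card_compatible_old card_compatible_new)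
  also have "real \<dots> = num_pairs / 2 ^ N"
    unfolding num_pairs_eq by simp
  finally show ?thesis by simp
qed

subsection \<open>Typical second phases\<close>

lemma card_answer_differs_le:
  assumes x: "x \<in> possible_keys s i" and i: "i < m"
  shows "card {c \<in> \<Omega>\<^sub>2. ans2 (upd s c) i x \<noteq> ans1 s i x} \<le> m / q * card \<Omega>\<^sub>2"
proof -
  obtain d \<gamma> where d: "(d, \<gamma>) \<in> \<Omega>\<^sub>1" "enc (d, \<gamma>) = s" "fst (d i) = x"
    using x by (auto simp: possible_keys_def encoded_by_def)
  have "ans2 (upd s c) i x = ans1 s i x" if "c \<in> \<Omega>\<^sub>2" "\<not> collide m d c" for c
    using ans1_old[of d \<gamma> i] ans2_old[of d \<gamma> c i] d that i by (simp add: both_phases_def)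
  then have "card {c \<in> \<Omega>\<^sub>2. ans2 (upd s c) i x \<noteq> ans1 s i x} \<le> card {c \<in> \<Omega>\<^sub>2. collide m d c}"
    by (intro card_mono) auto
  also have "real \<dots> \<le> m / q * card \<Omega>\<^sub>2"
    using m_le q_pos by (rule card_collide_le)
  finally show ?thesis by simp
qed

lemma sum_card_altered_le:
  "(\<Sum>c\<in>\<Omega>\<^sub>2. card (altered s (upd s c))) \<le> (real m)\<^sup>2 * card \<Omega>\<^sub>2"
proof -
  let ?K = "SIGMA i : {..<m}. possible_keys s i"
  have altered_eq: "altered s (upd s c) =
      {y \<in> ?K. ans2 (upd s c) (fst y) (snd y) \<noteq> ans1 s (fst y) (snd y)}" for c
    by (auto simp: altered_def changed_def)
  have "card ?K \<le> card ({..<m} \<times> {..<q})"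
    using possible_keys_subset by (intro card_mono) auto
  then have card_K: "real (card ?K) \<le> m * real q"
    by (simp only: card_cartesian_product card_lessThan of_nat_le_iff flip: of_nat_mult)
  have "(\<Sum>c\<in>\<Omega>\<^sub>2. card (altered s (upd s c))) \<le> card ?K * (m / q * card \<Omega>\<^sub>2)"
    unfolding altered_eq
  proof (rule sum_card_le_by_columns)
    fix y assume "y \<in> ?K"
    then show "card {c \<in> \<Omega>\<^sub>2. ans2 (upd s c) (fst y) (snd y) \<noteq> ans1 s (fst y) (snd y)}
        \<le> m / q * card \<Omega>\<^sub>2"
      by (intro card_answer_differs_le) auto
  qed auto
  also have "\<dots> \<le> m * real q * (m / q * card \<Omega>\<^sub>2)"
    using card_K by (intro mult_right_mono) auto
  also have "\<dots> = (real m)\<^sup>2 * card \<Omega>\<^sub>2"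
    using q_pos by (simp add: power2_eq_square)
  finally show ?thesis .
qed

lemma card_many_altered_le:
  "card {c \<in> \<Omega>\<^sub>2. 8 * q \<le> card (altered s (upd s c))} \<le> card \<Omega>\<^sub>2 / 32"
proof -
  let ?many = "{c \<in> \<Omega>\<^sub>2. 8 * real q \<le> card (altered s (upd s c))}"
  have "8 * real q * card ?many \<le> (\<Sum>c\<in>\<Omega>\<^sub>2. card (altered s (upd s c)))"
    using markov_inequality_card[of \<Omega>\<^sub>2 "\<lambda>c. card (altered s (upd s c))" "8 * real q"] by simp
  also have "\<dots> \<le> (real m)\<^sup>2 * card \<Omega>\<^sub>2"
    by (rule sum_card_altered_le)
  also have "\<dots> \<le> q / 4 * card \<Omega>\<^sub>2"
    using of_nat_mono[OF q_ge, where ?'a = real] by (intro mult_right_mono) simp_all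
  finally have "real q * card ?many \<le> q * (card \<Omega>\<^sub>2 / 32)" by simp
  then have "card ?many \<le> card \<Omega>\<^sub>2 / 32"
    using q_pos by simp
  moreover have "8 * real q \<le> card B \<longleftrightarrow> 8 * q \<le> card B" for B :: "(nat \<times> nat) set"
    by linarith
  ultimately show ?thesis by simp
qed

lemma card_half_colliding_le:
  assumes "encoded_by s \<noteq> {}"
  shows "card {c \<in> \<Omega>\<^sub>2. card (encoded_by s) \<le> 2 * card (colliding s c)} \<le> card \<Omega>\<^sub>2 / 32"
proof -
  let ?half = "{c \<in> \<Omega>\<^sub>2. card (encoded_by s) / 2 \<le> card (colliding s c)}"
  have "card (encoded_by s) / 2 * card ?half \<le> (\<Sum>c\<in>\<Omega>\<^sub>2. card (colliding s c))"
    using markov_inequality_card[of \<Omega>\<^sub>2 "\<lambda>c. card (colliding s c)" "card (encoded_by s) / 2"]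
    by simp
  also have "\<dots> \<le> card (encoded_by s) * (m / q * card \<Omega>\<^sub>2)"
    unfolding colliding_def using m_le q_pos by (intro sum_card_le_by_columns card_collide_le) auto
  also have "\<dots> \<le> card (encoded_by s) * (1 / 64 * card \<Omega>\<^sub>2)"
    using m_div_q_le by (intro mult_left_mono mult_right_mono) auto
  finally have "card (encoded_by s) * real (card ?half) \<le> card (encoded_by s) * (card \<Omega>\<^sub>2 / 32)"
    by simp
  moreover have "0 < card (encoded_by s)"
    using assms by (simp add: card_gt_0_iff)
  ultimately have "card ?half \<le> card \<Omega>\<^sub>2 / 32" by simp
  moreover have "?half = {c \<in> \<Omega>\<^sub>2. card (encoded_by s) \<le> 2 * card (colliding s c)}" by auto
  ultimately show ?thesis by simp
qed

lemma sum_possible_keys_ge: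
  assumes "real q ^ m / 2 ^ r \<le> card (encoded_by s)"
  shows "overlap m r \<le> (\<Sum>i<m. card (possible_keys s i) / q)"
proof -
  let ?x = "\<lambda>i. card (possible_keys s i) / real q"
  have "real q ^ m / 2 ^ r \<le> (\<Prod>i<m. real (card (possible_keys s i)))"
    using assms of_nat_mono[OF card_encoded_by_le[of s], where ?'a = real] by simp
  then have "2 powr (- real r) \<le> (\<Prod>i<m. ?x i)"
    using q_pos by (simp add: prod_dividef powr_minus powr_realpow divide_simps mult.commute)
  then have "(2 powr (- real r)) powr (1 / m) \<le> (\<Prod>i<m. ?x i) powr (1 / m)"
    by (intro powr_mono2) auto
  also have "\<dots> \<le> (\<Sum>i<m. ?x i / m)"
    using arith_geom_mean[of "{..<m}" ?x] m_ge by (simp add: lessThan_empty_iff)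
  finally have "2 powr (- (r / m)) \<le> (\<Sum>i<m. ?x i) / m"
    by (simp add: powr_powr sum_divide_distrib)
  then show ?thesis
    using m_ge by (simp add: overlap_def pos_le_divide_eq mult.commute)
qed

lemma possible_keys_le_changed:
  assumes i: "i < m"
  shows "card (possible_keys s i) / q
    \<le> 2 * (card {z \<in> {..<q} \<times> bitstrings v. changed s i z} / card ({..<q} \<times> bitstrings v))"
proof -
  let ?changed = "{z \<in> {..<q} \<times> bitstrings v. changed s i z}"
  have changed_eq: "?changed = (SIGMA x : possible_keys s i. bitstrings v - {ans1 s i x})"
    using possible_keys_subset[OF i, of s] by (auto simp: changed_def)
  have "2 ^ v \<le> 2 * card (bitstrings v - {f})" for f
  proof -
    have "(2::nat) ^ v - 1 \<le> card (bitstrings v - {f})"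
      using diff_card_le_card_Diff[of "{f}" "bitstrings v"] by simp
    moreover have "(2::nat) \<le> 2 ^ v"
      using power_increasing[of 1 v "2::nat"] v_pos by simp
    ultimately show ?thesis by linarith
  qed
  then have "(\<Sum>x\<in>possible_keys s i. 2 ^ v)
      \<le> (\<Sum>x\<in>possible_keys s i. 2 * card (bitstrings v - {ans1 s i x}))"
    by (intro sum_mono)
  also have "\<dots> = 2 * card ?changed"
    unfolding changed_eq by (simp add: sum_distrib_left)
  finally have "card (possible_keys s i) * 2 ^ v \<le> 2 * card ?changed" by simp
  from of_nat_mono[OF this, where ?'a = real]
  have "real (card (possible_keys s i)) * 2 ^ v \<le> 2 * card ?changed" by simp
  then show ?thesis
    using q_pos by (simp add: card_cartesian_product field_simps)
qed

lemma card_few_changed_le: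
  assumes encoded: "real q ^ m / 2 ^ r \<le> card (encoded_by s)"
    and h_le: "8 * real h \<le> overlap m r" and overlap_ge: "40 \<le> overlap m r"
  shows "card {c \<in> \<Omega>\<^sub>2. card (changed_blocks s c) \<le> h} \<le> card \<Omega>\<^sub>2 / 32"
proof -
  let ?few = "{c \<in> \<Omega>\<^sub>2. card (changed_blocks s c) \<le> h}"
  let ?S = "\<Sum>i<m. card {z \<in> {..<q} \<times> bitstrings v. changed s i z} / card ({..<q} \<times> bitstrings v)"
  have "overlap m r \<le> (\<Sum>i<m. card (possible_keys s i) / q)"
    by (rule sum_possible_keys_ge[OF encoded])
  also have "\<dots> \<le> 2 * ?S"
    unfolding sum_distrib_left by (intro sum_mono possible_keys_le_changed) simp
  finally have mean_ge: "overlap m r / 2 \<le> ?S" by simp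
  have "(1 / 2) ^ h * card ?few \<le> card \<Omega>\<^sub>2 * exp ((1 / 2 - 1) * ?S)"
    unfolding assignments_def changed_blocks_def using m_le by (intro card_PiE_lower_tail_le) auto
  also have "\<dots> \<le> card \<Omega>\<^sub>2 * exp (- overlap m r / 4)"
    using mean_ge by (intro mult_left_mono) auto
  finally have "card ?few \<le> card \<Omega>\<^sub>2 * (2 ^ h * exp (- overlap m r / 4))"
    by (simp add: power_one_over field_simps)
  also have "\<dots> \<le> card \<Omega>\<^sub>2 * (1 / 32)"
    by (intro mult_left_mono power_two_exp_le[OF h_le overlap_ge]) simp
  finally show ?thesis by simp
qed

definition typical :: "nat \<Rightarrow> bits \<Rightarrow> assignment \<Rightarrow> bool" where
  "typical h s c \<longleftrightarrow> card (altered s (upd s c)) < 8 * q \<and>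
    2 * card (colliding s c) < card (encoded_by s) \<and>
    h < card (changed_blocks s c)"

lemma card_atypical_le:
  assumes encoded: "real q ^ m / 2 ^ r \<le> card (encoded_by s)"
    and h_le: "8 * real h \<le> overlap m r" and overlap_ge: "40 \<le> overlap m r"
  shows "card {c \<in> \<Omega>\<^sub>2. \<not> typical h s c} \<le> 3 / 32 * card \<Omega>\<^sub>2"
proof -
  let ?A = "{c \<in> \<Omega>\<^sub>2. 8 * q \<le> card (altered s (upd s c))}"
  let ?B = "{c \<in> \<Omega>\<^sub>2. card (encoded_by s) \<le> 2 * card (colliding s c)}"
  let ?C = "{c \<in> \<Omega>\<^sub>2. card (changed_blocks s c) \<le> h}"
  have "encoded_by s \<noteq> {}"
  proof
    assume "encoded_by s = {}"
    moreover have "0 < real q ^ m / 2 ^ r" using q_pos by simp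
    ultimately show False using encoded by simp
  qed
  have "{c \<in> \<Omega>\<^sub>2. \<not> typical h s c} = ?A \<union> ?B \<union> ?C"
    by (auto simp: typical_def not_less)
  then have "card {c \<in> \<Omega>\<^sub>2. \<not> typical h s c} \<le> card ?A + card ?B + card ?C"
    using card_Un_le[of "?A \<union> ?B" ?C] card_Un_le[of ?A ?B] by simp
  then show ?thesis
    using card_many_altered_le[of s] card_half_colliding_le[OF \<open>encoded_by s \<noteq> {}\<close>]
      card_few_changed_le[OF assms] by linarith
qed

subsection \<open>Counting the typical runs that reach a given state\<close>

lemma sum_changed_answers_eq:
  "(\<Sum>i<m. card {z \<in> SIGMA x : {..<q}. {ans2 s' i x}. changed s i z}
      / card (SIGMA x : {..<q}. {ans2 s' i x})) = card (altered s s') / q"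
proof -
  have "card {z \<in> SIGMA x : {..<q}. {ans2 s' i x}. changed s i z}
      = card {x. changed s i (x, ans2 s' i x)}" if "i < m" for i
  proof (rule bij_betw_same_card)
    show "bij_betw fst {z \<in> SIGMA x : {..<q}. {ans2 s' i x}. changed s i z}
        {x. changed s i (x, ans2 s' i x)}"
      using possible_keys_subset[OF that, of s]
      by (intro bij_betw_byWitness[where f' = "\<lambda>x. (x, ans2 s' i x)"]) (auto simp: changed_def)
  qed
  then show ?thesis
    by (simp add: altered_def changed_def flip: sum_divide_distrib)
qed

definition typical_successors :: "nat \<Rightarrow> bits \<Rightarrow> bits \<Rightarrow> assignment set" where
  "typical_successors h s s' = {c. upd s c = s' \<and> typical h s c \<and> (\<exists>\<omega>\<in>encoded_by s. (\<omega>, c) \<in> \<Omega>)}"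

definition typical_predecessors :: "nat \<Rightarrow> bits \<Rightarrow> stored_data set" where
  "typical_predecessors h s' = {\<omega> \<in> \<Omega>\<^sub>1. \<exists>c\<in>\<Omega>\<^sub>2. upd (enc \<omega>) c = s' \<and> typical h (enc \<omega>) c}"

lemma finite_typical_successors [simp]: "finite (typical_successors h s s')"
  by (rule finite_subset[of _ "\<Omega>\<^sub>2"]) (auto simp: typical_successors_def both_phases_def)

lemma finite_typical_predecessors [simp]: "finite (typical_predecessors h s')"
  by (simp add: typical_predecessors_def)

lemma typical_successors_subset:
  "typical_successors h s s' \<subseteq> {c \<in> compatible_new s'. h \<le> card (changed_blocks s c)}"
proof
  fix c assume c: "c \<in> typical_successors h s s'"
  then obtain \<omega> where "(\<omega>, c) \<in> \<Omega>" "upd (enc \<omega>) c = s'"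
    by (auto simp: typical_successors_def encoded_by_def)
  then have "c \<in> compatible_new s'"
    using new_compatible[of \<omega> c] by (simp only:)
  then show "c \<in> {c \<in> compatible_new s'. h \<le> card (changed_blocks s c)}"
    using c by (simp add: typical_successors_def typical_def)
qed

lemma card_typical_successors_le:
  fixes t :: real
  assumes t: "1 \<le> t"
  shows "t ^ h * card (typical_successors h s s') \<le> q ^ p * exp (8 * t)"
proof (cases "typical_successors h s s' = {}")
  case True
  then show ?thesis by simp
next
  case False
  then have few_altered: "card (altered s s') < 8 * q"
    by (auto simp: typical_successors_def typical_def)
  have "(t - 1) * (card (altered s s') / q) \<le> (t - 1) * 8"
    using few_altered q_pos t by (intro mult_left_mono) (auto simp: divide_simps)
  then have exponent: "(t - 1) * (card (altered s s') / q) \<le> 8 * t" by simp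
  have "t ^ h * card (typical_successors h s s')
      \<le> t ^ h * card {c \<in> compatible_new s'. h \<le> card (changed_blocks s c)}"
    using t typical_successors_subset by (intro mult_left_mono of_nat_mono card_mono) auto
  also have "\<dots> \<le> card (compatible_new s') * exp ((t - 1) * (card (altered s s') / q))"
    unfolding answered_assignments_def changed_blocks_def sum_changed_answers_eq[symmetric]
    using t m_le by (intro card_PiE_upper_tail_le) auto
  also have "\<dots> \<le> card (compatible_new s') * exp (8 * t)"
    using exponent by (intro mult_left_mono) auto
  finally show ?thesis by (simp add: card_compatible_new)
qed

text \<open>For a typical \<open>c\<close>, half of the first phases encoded by \<open>s\<close> can be continued by \<open>c\<close>, so their
  values are dictated by \<open>s'\<close>; this is what makes \<open>s'\<close> pay for the values of the old keys as well.\<close>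

lemma card_typical_predecessors_le:
  "card (typical_predecessors h s') \<le> 2 * (q ^ m * 2 ^ (p * v))"
proof -
  let ?P = "typical_predecessors h s'" and ?Q = "\<lambda>s c. c \<in> \<Omega>\<^sub>2 \<and> upd s c = s' \<and> typical h s c"
  have "\<forall>s\<in>enc ` ?P. \<exists>c. ?Q s c" by (auto simp: typical_predecessors_def)
  then obtain c where c: "\<forall>s\<in>enc ` ?P. ?Q s (c s)"
    by (rule bchoice [THEN exE])
  let ?free = "{\<omega> \<in> ?P. \<not> collide m (fst \<omega>) (c (enc \<omega>))}"
  have "card {\<omega> \<in> ?P. enc \<omega> = s} \<le> 2 * card {\<omega> \<in> ?free. enc \<omega> = s}" for s
  proof (cases "s \<in> enc ` ?P")
    case True
    then have P_fibre: "{\<omega> \<in> ?P. enc \<omega> = s} = encoded_by s"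
      and free_fibre: "{\<omega> \<in> ?free. enc \<omega> = s} = encoded_by s - colliding s (c s)"
      by (auto simp: typical_predecessors_def encoded_by_def colliding_def)
    have "2 * card (colliding s (c s)) < card (encoded_by s)"
      using bspec[OF c True] by (simp add: typical_def)
    then show ?thesis
      unfolding P_fibre free_fibre by (subst card_Diff_subset) (auto simp: colliding_def)
  next
    case False
    then have empty: "{\<omega> \<in> ?P. enc \<omega> = s} = {}" by blast
    show ?thesis unfolding empty by simp
  qed
  then have "card ?P \<le> 2 * card ?free"
    by (rule card_le_by_fibres[rotated 2]) auto
  moreover have "?free \<subseteq> compatible_old s'"
  proof
    fix \<omega> assume \<omega>: "\<omega> \<in> ?free"
    then have "enc \<omega> \<in> enc ` ?P" by blast
    with \<omega> have "(\<omega>, c (enc \<omega>)) \<in> \<Omega>" "upd (enc \<omega>) (c (enc \<omega>)) = s'"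
      using bspec[OF c \<open>enc \<omega> \<in> enc ` ?P\<close>] by (auto simp: both_phases_def typical_predecessors_def)
    then show "\<omega> \<in> compatible_old s'"
      using old_compatible[of \<omega> "c (enc \<omega>)"] by (simp only:)
  qed
  then have "card ?free \<le> q ^ m * 2 ^ (p * v)"
    unfolding card_compatible_old[of s', symmetric] by (intro card_mono finite_compatible_old)
  ultimately show ?thesis by linarith
qed

definition typical_runs :: "nat \<Rightarrow> (stored_data \<times> assignment) set" where
  "typical_runs h = {\<tau> \<in> \<Omega>. typical h (enc (fst \<tau>)) (snd \<tau>)}"

lemma finite_typical_runs [simp]: "finite (typical_runs h)"
  by (simp add: typical_runs_def)

lemma card_typical_runs_fibre_le:
  fixes t :: real
  assumes t: "1 \<le> t"
  shows "card {\<tau> \<in> typical_runs h. enc2 \<tau> = s'}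
    \<le> 2 * (q ^ m * 2 ^ (p * v)) * (q ^ p * exp (8 * t) / t ^ h)"
proof -
  let ?runs = "SIGMA \<omega> : typical_predecessors h s'. typical_successors h (enc \<omega>) s'"
  have "{\<tau> \<in> typical_runs h. enc2 \<tau> = s'} \<subseteq> ?runs"
  proof (rule subrelI)
    fix \<omega> c assume run: "(\<omega>, c) \<in> {\<tau> \<in> typical_runs h. enc2 \<tau> = s'}"
    then have "\<omega> \<in> encoded_by (enc \<omega>)"
      by (simp add: typical_runs_def both_phases_def encoded_by_def)
    with run show "(\<omega>, c) \<in> ?runs"
      by (auto simp: typical_runs_def typical_predecessors_def typical_successors_def
          both_phases_def)
  qed
  then have "card {\<tau> \<in> typical_runs h. enc2 \<tau> = s'} \<le> card ?runs"
    by (intro card_mono) auto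
  also have "real \<dots> \<le> card (typical_predecessors h s') * (q ^ p * exp (8 * t) / t ^ h)"
  proof (rule card_Sigma_le)
    show "card (typical_successors h (enc \<omega>) s') \<le> q ^ p * exp (8 * t) / t ^ h" for \<omega>
      using card_typical_successors_le[OF t] t by (simp add: pos_le_divide_eq mult.commute)
  qed auto
  also have "\<dots> \<le> real (2 * (q ^ m * 2 ^ (p * v))) * (q ^ p * exp (8 * t) / t ^ h)"
    using t by (intro mult_right_mono of_nat_mono card_typical_predecessors_le) auto
  finally show ?thesis by simp
qed

lemma card_short_typical_runs_le:
  fixes t :: real
  assumes t: "1 \<le> t"
  shows "t ^ h * card {\<tau> \<in> typical_runs h. length (enc2 \<tau>) \<le> N + k}
    \<le> 2 ^ (k + 2) * exp (8 * t) * num_pairs"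
proof -
  have "card {\<tau> \<in> typical_runs h. length (enc2 \<tau>) \<le> N + k}
      \<le> 2 ^ (N + k + 1) * (2 * (q ^ m * 2 ^ (p * v)) * (q ^ p * exp (8 * t) / t ^ h))"
    by (intro card_short_codes_le card_typical_runs_fibre_le t) simp
  also have "\<dots> = 2 ^ (k + 2) * exp (8 * t) * num_pairs / t ^ h"
    unfolding num_pairs_eq by (simp add: power_add mult_ac)
  finally show ?thesis
    using t by (simp add: pos_le_divide_eq mult.commute)
qed

subsection \<open>Typical runs of small total length\<close>

definition total_length :: nat where
  "total_length = (\<Sum>\<tau>\<in>\<Omega>. length (enc (fst \<tau>)) + length (enc2 \<tau>))"

lemma card_rarely_encoded_le:
  "card {\<omega> \<in> \<Omega>\<^sub>1. length (enc \<omega>) \<le> N + k \<and> card (encoded_by (enc \<omega>)) \<le> real q ^ m / 2 ^ (k + 4)}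
    \<le> 1 / 8 * card \<Omega>\<^sub>1"
proof -
  have "card {\<omega> \<in> \<Omega>\<^sub>1. length (enc \<omega>) \<le> N + k \<and>
        card (encoded_by (enc \<omega>)) \<le> real q ^ m / 2 ^ (k + 4)}
      \<le> 2 ^ (N + k + 1) * (real q ^ m / 2 ^ (k + 4))"
    unfolding encoded_by_def by (rule card_short_rare_codes_le) auto
  also have "\<dots> = 1 / 8 * card \<Omega>\<^sub>1"
    by (simp add: card_first_phase power_add)
  finally show ?thesis .
qed

context
  fixes R :: real and k h :: nat
  assumes total_length_le: "total_length \<le> 2 * card \<Omega> * (N + R)"
    and R_nonneg: "0 \<le> R" and k_ge: "8 * R + 20 \<le> k"
    and h_le: "8 * real h \<le> overlap m (k + 4)" and overlap_ge: "40 \<le> overlap m (k + 4)"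
begin

lemma card_long_le:
  "card {\<tau> \<in> \<Omega>. N + k < length (enc (fst \<tau>))} + card {\<tau> \<in> \<Omega>. N + k < length (enc2 \<tau>)}
    \<le> 1 / 4 * card \<Omega>"
proof -
  let ?long = "{\<tau> \<in> \<Omega>. N + k < length (enc (fst \<tau>))}"
  let ?long2 = "{\<tau> \<in> \<Omega>. N + k < length (enc2 \<tau>)}"
  have excess_enc: "real k * card ?long
      \<le> (\<Sum>\<tau>\<in>\<Omega>. real (length (enc (fst \<tau>))) - real N) + 2 * 2 ^ N * (num_pairs / 2 ^ N)"
    by (intro card_long_codes_le card_enc_fibre_le) simp
  have excess_enc2: "real k * card ?long2
      \<le> (\<Sum>\<tau>\<in>\<Omega>. real (length (enc2 \<tau>)) - real N) + 2 * 2 ^ N * (num_pairs / 2 ^ N)"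
    by (intro card_long_codes_le card_enc2_fibre_le) simp
  have "real k * (card ?long + card ?long2) = real k * card ?long + real k * card ?long2"
    by (simp add: distrib_left)
  also have "\<dots> \<le> total_length - 2 * card \<Omega> * real N + 4 * num_pairs"
    using add_mono[OF excess_enc excess_enc2]
    by (simp add: total_length_def sum.distrib sum_subtractf algebra_simps)
  also have "\<dots> \<le> 2 * R * card \<Omega> + 5 * card \<Omega>"
    using total_length_le num_pairs_le_card_both_phases by (simp add: algebra_simps)
  also have "\<dots> = (8 * R + 20) * (1 / 4 * card \<Omega>)"
    by (simp add: field_simps)
  also have "\<dots> \<le> real k * (1 / 4 * card \<Omega>)"
    using k_ge by (intro mult_right_mono) auto
  finally show ?thesis
    using R_nonneg k_ge by simp
qed

lemma card_short_typical_runs_ge: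
  "num_pairs / 4 \<le> card {\<tau> \<in> typical_runs h. length (enc2 \<tau>) \<le> N + k}"
proof -
  let ?long = "{\<tau> \<in> \<Omega>. N + k < length (enc (fst \<tau>))}"
  let ?long2 = "{\<tau> \<in> \<Omega>. N + k < length (enc2 \<tau>)}"
  let ?rare = "{\<omega> \<in> \<Omega>\<^sub>1. length (enc \<omega>) \<le> N + k \<and>
      card (encoded_by (enc \<omega>)) \<le> real q ^ m / 2 ^ (k + 4)}"
  let ?frequent = "{\<omega> \<in> \<Omega>\<^sub>1. real q ^ m / 2 ^ (k + 4) \<le> card (encoded_by (enc \<omega>))}"
  let ?atypical = "SIGMA \<omega> : ?frequent. {c \<in> \<Omega>\<^sub>2. \<not> typical h (enc \<omega>) c}"
  let ?short = "{\<tau> \<in> typical_runs h. length (enc2 \<tau>) \<le> N + k}"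
  have "\<Omega> \<subseteq> ?long \<union> ?long2 \<union> ?rare \<times> \<Omega>\<^sub>2 \<union> ?atypical \<union> ?short"
    by (auto simp: typical_runs_def both_phases_def not_le)
  then have "card \<Omega> \<le> card (?long \<union> ?long2 \<union> ?rare \<times> \<Omega>\<^sub>2 \<union> ?atypical \<union> ?short)"
    by (intro card_mono) auto
  then have "card \<Omega> \<le> card ?long + card ?long2 + card (?rare \<times> \<Omega>\<^sub>2) + card ?atypical + card ?short"
    using card_Un_le[of "?long \<union> ?long2 \<union> ?rare \<times> \<Omega>\<^sub>2 \<union> ?atypical" ?short]
      card_Un_le[of "?long \<union> ?long2 \<union> ?rare \<times> \<Omega>\<^sub>2" ?atypical]
      card_Un_le[of "?long \<union> ?long2" "?rare \<times> \<Omega>\<^sub>2"] card_Un_le[of ?long ?long2] by linarith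
  moreover have "card (?rare \<times> \<Omega>\<^sub>2) \<le> 1 / 8 * num_pairs"
    using mult_right_mono[OF card_rarely_encoded_le, of "card \<Omega>\<^sub>2"]
    by (simp add: card_cartesian_product)
  moreover have "card ?atypical \<le> 3 / 32 * num_pairs"
  proof -
    have "card ?atypical \<le> card ?frequent * (3 / 32 * card \<Omega>\<^sub>2)"
      using h_le overlap_ge by (intro card_Sigma_le card_atypical_le[where r = "k + 4"]) auto
    also have "\<dots> \<le> card \<Omega>\<^sub>1 * (3 / 32 * card \<Omega>\<^sub>2)"
      by (intro mult_right_mono of_nat_mono card_mono) auto
    finally show ?thesis by simp
  qed
  ultimately show ?thesis
    using card_long_le num_pairs_le_card_both_phases num_pairs_pos by linarith
qed

lemma power_le_of_small_total_length:
  fixes t :: real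
  assumes t: "1 \<le> t"
  shows "t ^ h \<le> 2 ^ (k + 4) * exp (8 * t)"
proof -
  let ?short = "real (card {\<tau> \<in> typical_runs h. length (enc2 \<tau>) \<le> N + k})"
  have "t ^ h * (num_pairs / 4) \<le> t ^ h * ?short"
    using card_short_typical_runs_ge t by (intro mult_left_mono) auto
  also have "\<dots> \<le> 2 ^ (k + 2) * exp (8 * t) * num_pairs"
    by (rule card_short_typical_runs_le[OF t])
  finally have "t ^ h * num_pairs \<le> (2 ^ (k + 4) * exp (8 * t)) * num_pairs"
    by (simp add: power_add)
  then show ?thesis using num_pairs_pos by (simp only: mult_le_cancel_right_pos)
qed

end

lemma total_length_ge:
  fixes R :: real
  assumes "forces_excess m R"
  shows "2 * card \<Omega> * (N + R) \<le> total_length"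
proof (rule ccontr)
  assume small: "\<not> ?thesis"
  obtain k h and t :: real where "0 \<le> R" "8 * R + 20 \<le> real k" "8 * real h \<le> overlap m (k + 4)"
    "40 \<le> overlap m (k + 4)" "1 \<le> t" "2 ^ (k + 4) * exp (8 * t) < t ^ h"
    using assms unfolding forces_excess_def by blast
  with small show False
    using power_le_of_small_total_length[of R k h t] by simp
qed

end

section \<open>Realisation by operation sequences\<close>

lemma run_from_append:
  "run_from D \<omega> t s (xs @ ys) = run_from D \<omega> (t + length xs) (run_from D \<omega> t s xs) ys"
  by (induction xs arbitrary: t s) auto

lemma admissible_from_append:
  "admissible_from U n v M (xs @ ys) \<longleftrightarrow>
     admissible_from U n v M xs \<and> admissible_from U n v (foldl apply_op M xs) ys"
  by (induction xs arbitrary: M) auto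

definition insert_ops :: "(nat \<times> bits) list \<Rightarrow> operation list" where
  "insert_ops kvs = map (\<lambda>(k, f). Insert k f) kvs"

definition storable :: "nat set \<Rightarrow> nat \<Rightarrow> nat \<Rightarrow> (nat \<times> bits) list \<Rightarrow> bool" where
  "storable U n v kvs \<longleftrightarrow>
     distinct (map fst kvs) \<and> set kvs \<subseteq> U \<times> bitstrings v \<and> length kvs \<le> n"

lemma length_insert_ops [simp]: "length (insert_ops kvs) = length kvs"
  by (simp add: insert_ops_def)

lemma foldl_insert_ops:
  "distinct (map fst kvs) \<Longrightarrow> foldl apply_op M (insert_ops kvs) = M ++ map_of kvs"
  by (induction kvs arbitrary: M)
    (auto simp: insert_ops_def dom_map_of_conv_image_fst map_add_upd_left)

lemma foldl_delete_ops: "foldl apply_op M (map Delete ks) = M |` (- set ks)"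
  by (induction ks arbitrary: M) (auto simp: restrict_map_def fun_eq_iff)

lemma admissible_insert_ops:
  assumes "distinct (map fst kvs)" "set kvs \<subseteq> U \<times> bitstrings v" "fst ` set kvs \<inter> dom M = {}"
    and "finite (dom M)" "card (dom M) + length kvs \<le> n"
  shows "admissible_from U n v M (insert_ops kvs)"
  using assms
proof (induction kvs arbitrary: M)
  case (Cons kv kvs)
  obtain k f where kv: "kv = (k, f)" by fastforce
  have new: "k \<notin> dom M" "k \<in> U" "length f = v"
    using Cons.prems by (auto simp: kv bitstrings_def)
  have "admissible_from U n v (M(k \<mapsto> f)) (insert_ops kvs)"
  proof (rule Cons.IH)
    show "fst ` set kvs \<inter> dom (M(k \<mapsto> f)) = {}"
      using Cons.prems(1,3) unfolding kv dom_fun_upd by simp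
    show "card (dom (M(k \<mapsto> f))) + length kvs \<le> n"
      using Cons.prems(4,5) new unfolding dom_fun_upd by simp
    show "finite (dom (M(k \<mapsto> f)))"
      using Cons.prems(4) unfolding dom_fun_upd by simp
  qed (use Cons.prems in simp_all)
  then show ?case
    using Cons.prems(5) new by (simp add: kv insert_ops_def)
qed (simp add: insert_ops_def)

lemma admissible_delete_ops:
  assumes "distinct ks" "set ks \<subseteq> dom M"
  shows "admissible_from U n v M (map Delete ks)"
  using assms
proof (induction ks arbitrary: M)
  case (Cons k ks)
  have "admissible_from U n v (M(k := None)) (map Delete ks)"
    using Cons.prems by (intro Cons.IH) auto
  then show ?case using Cons.prems by auto
qed simp

lemma insert_ops_in_op_sequences:
  "storable U n v kvs \<Longrightarrow> insert_ops kvs \<in> op_sequences U n v"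
  by (auto simp: storable_def op_sequences_def intro!: admissible_insert_ops)

lemma contents_insert_ops:
  "storable U n v kvs \<Longrightarrow> contents (insert_ops kvs) = map_of kvs"
  by (simp add: storable_def contents_def foldl_insert_ops)

definition replace_ops :: "nat list \<Rightarrow> (nat \<times> bits) list \<Rightarrow> operation list" where
  "replace_ops ks kvs = map Delete ks @ insert_ops kvs"

lemma restrict_map_of_append:
  assumes "distinct (map fst (as @ cs))"
  shows "map_of (as @ cs) |` (- fst ` set cs) = map_of as"
proof
  fix x
  show "(map_of (as @ cs) |` (- fst ` set cs)) x = map_of as x"
  proof (cases "x \<in> fst ` set cs")
    case True
    then have "x \<notin> fst ` set as" using assms by auto
    with True show ?thesis by (simp add: map_of_eq_None_iff[THEN iffD2])
  next
    case False
    then have "map_of cs x = None" by (simp add: map_of_eq_None_iff)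
    with False show ?thesis by (simp add: map_add_def split: option.split)
  qed
qed

lemma
  assumes ac: "storable U n v (as @ cs)" and ab: "storable U n v (as @ bs)"
  shows replace_ops_in_op_sequences:
      "insert_ops (as @ cs) @ replace_ops (map fst cs) bs \<in> op_sequences U n v"
    and contents_replace_ops:
      "contents (insert_ops (as @ cs) @ replace_ops (map fst cs) bs) = map_of (as @ bs)"
proof -
  have after_inserts: "foldl apply_op Map.empty (insert_ops (as @ cs)) = map_of (as @ cs)"
    using contents_insert_ops[OF ac] by (simp add: contents_def)
  have after_deletes: "foldl apply_op (map_of (as @ cs)) (map Delete (map fst cs)) = map_of as"
    unfolding foldl_delete_ops using restrict_map_of_append[of as cs] ac by (simp add: storable_def)
  have bs: "distinct (map fst bs)" "fst ` set bs \<inter> dom (map_of as) = {}"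
    using ab by (auto simp: storable_def dom_map_of_conv_image_fst)
  have "admissible_from U n v (map_of (as @ cs)) (map Delete (map fst cs))"
    using ac by (intro admissible_delete_ops) (auto simp: storable_def dom_map_of_conv_image_fst)
  moreover have "admissible_from U n v (map_of as) (insert_ops bs)"
    using ab bs card_length[of "map fst as"]
    by (intro admissible_insert_ops) (auto simp: storable_def dom_map_of_conv_image_fst)
  ultimately show "insert_ops (as @ cs) @ replace_ops (map fst cs) bs \<in> op_sequences U n v"
    using insert_ops_in_op_sequences[OF ac] after_inserts after_deletes
    by (simp add: op_sequences_def replace_ops_def admissible_from_append)
  show "contents (insert_ops (as @ cs) @ replace_ops (map fst cs) bs) = map_of (as @ bs)"
    using after_inserts after_deletes bs
    by (simp add: contents_def replace_ops_def foldl_insert_ops map_add_comm Int_commute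
        dom_map_of_conv_image_fst)
qed

lemma expected_size_ge_tapewise:
  assumes D: "dynamic_retrieval U n v M D"
    and S: "finite (set_pmf S)" "set_pmf S \<subseteq> op_sequences U n v"
    and ge: "\<And>\<omega>. \<omega> \<in> space M \<Longrightarrow> r \<le> (\<integral>\<^sup>+ xs. ennreal (length (state_after D \<omega> xs)) \<partial>S)"
  shows "r \<le> expected_size M D S"
proof -
  interpret prob_space M
    using D by (simp add: dynamic_retrieval_def)
  have meas: "(\<lambda>\<omega>. ennreal (length (state_after D \<omega> xs))) \<in> borel_measurable M"
    if "xs \<in> set_pmf S" for xs
  proof -
    have "(\<lambda>\<omega>. state_after D \<omega> xs) \<in> measurable M (count_space UNIV)"
      using D S that by (auto simp: dynamic_retrieval_def)
    then show ?thesis by (rule measurable_compose) simp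
  qed
  have "r = (\<integral>\<^sup>+ \<omega>. r \<partial>M)"
    by (simp add: emeasure_space_1)
  also have "\<dots> \<le> (\<integral>\<^sup>+ \<omega>. (\<integral>\<^sup>+ xs. ennreal (length (state_after D \<omega> xs)) \<partial>S) \<partial>M)"
    by (intro nn_integral_mono ge)
  also have "\<dots> = (\<integral>\<^sup>+ \<omega>. (\<Sum>xs\<in>set_pmf S. ennreal (length (state_after D \<omega> xs)) * pmf S xs) \<partial>M)"
    by (simp add: nn_integral_measure_pmf_finite S)
  also have "\<dots> = (\<Sum>xs\<in>set_pmf S. \<integral>\<^sup>+ \<omega>. ennreal (length (state_after D \<omega> xs)) * pmf S xs \<partial>M)"
    by (intro nn_integral_sum borel_measurable_times_ennreal meas) auto
  also have "\<dots> = (\<Sum>xs\<in>set_pmf S. (\<integral>\<^sup>+ \<omega>. ennreal (length (state_after D \<omega> xs)) \<partial>M) * pmf S xs)"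
    by (intro sum.cong refl nn_integral_multc meas)
  also have "\<dots> = expected_size M D S"
    by (simp add: expected_size_def nn_integral_measure_pmf_finite S)
  finally show ?thesis .
qed

locale key_blocks = phase_sizes +
  fixes U :: "nat set" and key :: "nat \<times> nat \<Rightarrow> nat"
  assumes inj_key: "inj_on key ({..<p} \<times> {..q})" and key_in_U: "key ` ({..<p} \<times> {..q}) \<subseteq> U"
begin

definition entries :: "nat \<Rightarrow> assignment \<Rightarrow> (nat \<times> bits) list" where
  "entries k d = map (\<lambda>i. (key (i, fst (d i)), snd (d i))) [0..<k]"

lemma storable_entries_append:
  assumes "k \<le> p" "l \<le> p"
    and "\<And>i. i < k \<Longrightarrow> d i \<in> {..q} \<times> bitstrings v" "\<And>i. i < l \<Longrightarrow> e i \<in> {..q} \<times> bitstrings v"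
    and "\<And>i. i < k \<Longrightarrow> i < l \<Longrightarrow> fst (d i) \<noteq> fst (e i)"
  shows "storable U (k + l) v (entries k d @ entries l e)"
proof -
  let ?pos = "map (\<lambda>i. (i, fst (d i))) [0..<k] @ map (\<lambda>i. (i, fst (e i))) [0..<l]"
  have "set ?pos \<subseteq> {..<p} \<times> {..q}"
    using assms by (fastforce simp: mem_Times_iff)
  moreover have "distinct ?pos"
    using assms(5) by (auto simp: distinct_map inj_on_def)
  ultimately have "distinct (map key ?pos)"
    unfolding distinct_map using inj_on_subset[OF inj_key] by blast
  moreover have "set (entries k d @ entries l e) \<subseteq> U \<times> bitstrings v"
    using assms(1-4) key_in_U by (fastforce simp: entries_def mem_Times_iff)
  ultimately show ?thesis
    by (simp add: storable_def entries_def comp_def)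
qed

lemma map_of_entries_append:
  assumes "storable U n v (entries k d @ entries l e)"
  shows "i < k \<Longrightarrow> map_of (entries k d @ entries l e) (key (i, fst (d i))) = Some (snd (d i))"
    and "i < l \<Longrightarrow> map_of (entries k d @ entries l e) (key (i, fst (e i))) = Some (snd (e i))"
  using assms
  by (auto simp: storable_def entries_def intro!: map_of_is_SomeI simp del: map_of_append)

definition first_ops :: "stored_data \<Rightarrow> operation list" where
  "first_ops = (\<lambda>(d, \<gamma>). insert_ops (entries m d @ entries p (\<lambda>j. (q, \<gamma> j))))"

definition second_ops :: "assignment \<Rightarrow> operation list" where
  "second_ops c = replace_ops (map (\<lambda>j. key (j, q)) [0..<p]) (entries p c)"

definition hard_distribution :: "operation list pmf" where
  "hard_distribution = map_pmf
    (\<lambda>((\<omega>, c), twice). first_ops \<omega> @ (if twice then second_ops c else []))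
    (pmf_of_set (\<Omega> \<times> UNIV))"

lemma length_first_ops: "length (first_ops \<omega>) = m + p"
  by (simp add: first_ops_def entries_def split: prod.split)

lemma length_both_ops: "length (first_ops \<omega> @ second_ops c) = m + p + 2 * p"
  by (simp add: length_first_ops second_ops_def replace_ops_def entries_def)

lemma storable_old_fixed:
  assumes "(d, \<gamma>) \<in> \<Omega>\<^sub>1"
  shows "storable U (m + p) v (entries m d @ entries p (\<lambda>j. (q, \<gamma> j)))"
  using assms m_le
  by (intro storable_entries_append)
    (auto simp: first_phase_def mem_Times_iff PiE_iff dest: assignmentsD less_imp_neq)

lemma storable_old_new:
  assumes "((d, \<gamma>), c) \<in> \<Omega>"
  shows "storable U (m + p) v (entries m d @ entries p c)"
  using assms m_le
  by (intro storable_entries_append)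
    (auto simp: both_phases_def first_phase_def collide_def mem_Times_iff less_imp_le
      dest: assignmentsD)

lemma first_ops_in_op_sequences:
  "\<omega> \<in> \<Omega>\<^sub>1 \<Longrightarrow> first_ops \<omega> \<in> op_sequences U (m + p) v"
  by (cases \<omega>) (simp add: first_ops_def insert_ops_in_op_sequences storable_old_fixed)

lemma
  assumes "(d, \<gamma>) \<in> \<Omega>\<^sub>1"
  shows contents_first_ops_old:
      "i < m \<Longrightarrow> contents (first_ops (d, \<gamma>)) (key (i, fst (d i))) = Some (snd (d i))"
    and contents_first_ops_fixed:
      "j < p \<Longrightarrow> contents (first_ops (d, \<gamma>)) (key (j, q)) = Some (\<gamma> j)"
  using map_of_entries_append[OF storable_old_fixed[OF assms]] storable_old_fixed[OF assms]
  by (simp_all add: first_ops_def contents_insert_ops)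

lemma
  assumes "((d, \<gamma>), c) \<in> \<Omega>"
  shows both_ops_in_op_sequences:
      "first_ops (d, \<gamma>) @ second_ops c \<in> op_sequences U (m + p) v"
    and contents_both_ops:
      "contents (first_ops (d, \<gamma>) @ second_ops c) = map_of (entries m d @ entries p c)"
proof -
  have "(d, \<gamma>) \<in> \<Omega>\<^sub>1"
    using assms by (simp add: both_phases_def)
  note storable = storable_old_fixed[OF this] storable_old_new[OF assms]
  have "map fst (entries p (\<lambda>j. (q, \<gamma> j))) = map (\<lambda>j. key (j, q)) [0..<p]"
    by (simp add: entries_def)
  then show "first_ops (d, \<gamma>) @ second_ops c \<in> op_sequences U (m + p) v"
    "contents (first_ops (d, \<gamma>) @ second_ops c) = map_of (entries m d @ entries p c)"
    using replace_ops_in_op_sequences[OF storable] contents_replace_ops[OF storable]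
    by (simp_all add: first_ops_def second_ops_def)
qed

lemma run_from_second_ops:
  "run_from D \<rho> (m + p) (state_after D \<rho> (first_ops \<omega>)) (second_ops c)
    = state_after D \<rho> (first_ops \<omega> @ second_ops c)"
  by (simp add: state_after_def run_from_append length_first_ops)

lemma two_phase_state_after:
  assumes D: "dynamic_retrieval U (m + p) v M D" and \<rho>: "\<rho> \<in> space M"
  shows "two_phase m p q v (\<lambda>\<omega>. state_after D \<rho> (first_ops \<omega>))
    (\<lambda>s c. run_from D \<rho> (m + p) s (second_ops c))
    (\<lambda>s i x. answer D \<rho> (m + p) s (key (i, x))) (\<lambda>s i x. answer D \<rho> (m + p + 2 * p) s (key (i, x)))"
proof -
  have answer: "answer D \<rho> t (state_after D \<rho> xs) k = f"
    if "xs \<in> op_sequences U (m + p) v" "length xs = t" "contents xs k = Some f" for xs t k f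
    using D \<rho> that by (auto simp: dynamic_retrieval_def)
  show ?thesis
  proof (unfold_locales, unfold run_from_second_ops)
    fix d \<gamma> assume \<omega>: "(d, \<gamma>) \<in> \<Omega>\<^sub>1"
    show "answer D \<rho> (m + p) (state_after D \<rho> (first_ops (d, \<gamma>))) (key (i, fst (d i))) = snd (d i)"
      if "i < m" for i
      by (intro answer first_ops_in_op_sequences contents_first_ops_old length_first_ops \<omega> that)
    show "answer D \<rho> (m + p) (state_after D \<rho> (first_ops (d, \<gamma>))) (key (j, q)) = \<gamma> j"
      if "j < p" for j
      by (intro answer first_ops_in_op_sequences contents_first_ops_fixed length_first_ops \<omega> that)
  next
    fix d \<gamma> c i assume \<tau>: "((d, \<gamma>), c) \<in> \<Omega>"
    note ops = both_ops_in_op_sequences[OF \<tau>] length_both_ops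
      and lookup = map_of_entries_append[OF storable_old_new[OF \<tau>]]
    show "answer D \<rho> (m + p + 2 * p) (state_after D \<rho> (first_ops (d, \<gamma>) @ second_ops c))
        (key (i, fst (d i))) = snd (d i)" if "i < m"
      by (intro answer ops) (simp only: contents_both_ops[OF \<tau>] lookup(1)[OF that])
    show "answer D \<rho> (m + p + 2 * p) (state_after D \<rho> (first_ops (d, \<gamma>) @ second_ops c))
        (key (i, fst (c i))) = snd (c i)" if "i < p"
      by (intro answer ops) (simp only: contents_both_ops[OF \<tau>] lookup(2)[OF that])
  qed
qed

lemma finite_set_hard_distribution: "finite (set_pmf hard_distribution)"
  and set_hard_distribution: "set_pmf hard_distribution \<subseteq> op_sequences U (m + p) v"
proof -
  have set_eq: "set_pmf hard_distribution
      = (\<lambda>((\<omega>, c), twice). first_ops \<omega> @ (if twice then second_ops c else [])) ` (\<Omega> \<times> UNIV)"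
    unfolding hard_distribution_def set_map_pmf using both_phases_nonempty
    by (subst set_pmf_of_set) auto
  show "finite (set_pmf hard_distribution)"
    unfolding set_eq by simp
  show "set_pmf hard_distribution \<subseteq> op_sequences U (m + p) v"
    unfolding set_eq using first_ops_in_op_sequences both_ops_in_op_sequences
    by (auto simp: both_phases_def)
qed

lemma nn_integral_hard_distribution:
  fixes f :: "operation list \<Rightarrow> real"
  assumes nonneg: "\<And>xs. 0 \<le> f xs"
  shows "(\<integral>\<^sup>+ xs. ennreal (f xs) \<partial>hard_distribution)
    = ennreal ((\<Sum>\<tau>\<in>\<Omega>. f (first_ops (fst \<tau>)) + f (first_ops (fst \<tau>) @ second_ops (snd \<tau>)))
      / (2 * card \<Omega>))" (is "_ = ennreal (?total / _)")
proof -
  let ?ops = "\<lambda>\<tau> twice. first_ops (fst \<tau>) @ (if twice then second_ops (snd \<tau>) else [])"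
  have "(\<integral>\<^sup>+ xs. ennreal (f xs) \<partial>hard_distribution)
      = (\<Sum>(\<tau>, twice)\<in>\<Omega> \<times> UNIV. ennreal (f (?ops \<tau> twice))) / card (\<Omega> \<times> (UNIV :: bool set))"
    unfolding hard_distribution_def nn_integral_map_pmf using both_phases_nonempty
    by (subst nn_integral_pmf_of_set) (auto simp: case_prod_beta)
  also have "\<dots> = ennreal ?total / card (\<Omega> \<times> (UNIV :: bool set))"
    using nonneg by (simp add: UNIV_bool add.commute flip: sum.cartesian_product sum_ennreal)
  also have "\<dots> = ennreal (?total / (2 * card \<Omega>))"
    using card_both_phases_pos nonneg
    by (simp add: card_cartesian_product ennreal_of_nat_eq_real_of_nat divide_ennreal mult.commute
        sum_nonneg del: of_nat_mult)
  finally show ?thesis .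
qed

lemma expected_size_hard_distribution_ge:
  fixes R :: real
  assumes D: "dynamic_retrieval U (m + p) v M D" and excess: "forces_excess m R"
  shows "ennreal (real N + R) \<le> expected_size M D hard_distribution"
proof (rule expected_size_ge_tapewise[OF D finite_set_hard_distribution set_hard_distribution])
  fix \<rho> assume "\<rho> \<in> space M"
  then interpret two_phase m p q v "\<lambda>\<omega>. state_after D \<rho> (first_ops \<omega>)"
    "\<lambda>s c. run_from D \<rho> (m + p) s (second_ops c)"
    "\<lambda>s i x. answer D \<rho> (m + p) s (key (i, x))" "\<lambda>s i x. answer D \<rho> (m + p + 2 * p) s (key (i, x))"
    by (rule two_phase_state_after[OF D])
  show "ennreal (real N + R) \<le> (\<integral>\<^sup>+ xs. ennreal (length (state_after D \<rho> xs)) \<partial>hard_distribution)"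
    using total_length_ge[OF excess] card_both_phases_pos
    unfolding run_from_second_ops total_length_def
    by (subst nn_integral_hard_distribution)
      (auto simp: pos_le_divide_eq mult.commute intro!: ennreal_leI)
qed

end

lemma inj_into_large_set:
  assumes "finite A" "infinite B \<or> card A \<le> card B"
  obtains f where "inj_on f A" "f ` A \<subseteq> B"
proof -
  obtain C where "C \<subseteq> B" "finite C" "card A \<le> card C"
    using assms infinite_arbitrarily_large[of B "card A"] by (cases "finite B") auto
  then show ?thesis
    using card_le_inj[OF \<open>finite A\<close>, of C] that by blast
qed

lemma key_blocks_exist:
  assumes U: "infinite U \<or> n ^ 3 \<le> card U" and n: "32 \<le> n" and v: "0 < v"
  obtains key where "key_blocks (n div 2) (n - n div 2) (n\<^sup>2) v U key"
proof -
  let ?pos = "{..<n - n div 2} \<times> {..n\<^sup>2}"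
  have "card ?pos = (n - n div 2) * Suc (n\<^sup>2)"
    by (simp add: card_cartesian_product)
  also have "\<dots> \<le> (n - 1) * Suc (n\<^sup>2)"
    using n by (intro mult_right_mono) auto
  also have "\<dots> \<le> n ^ 3"
    using n by (cases n) (auto simp: power2_eq_square power3_eq_cube algebra_simps)
  finally have "infinite U \<or> card ?pos \<le> card U"
    using U by (meson order_trans)
  then obtain key where "inj_on key ?pos" "key ` ?pos \<subseteq> U"
    by (rule inj_into_large_set[rotated]) auto
  moreover have "4 * (n div 2)\<^sup>2 \<le> n\<^sup>2"
    using power_mono[of "2 * (n div 2)" n 2] by (simp add: power_mult_distrib)
  moreover have "16 \<le> n div 2" "n div 2 \<le> n - n div 2"
    using n by linarith+
  ultimately show ?thesis
    using v that by (simp add: key_blocks_def key_blocks_axioms_def phase_sizes_def)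
qed

theorem theorem3:
  shows "\<exists>c > (0::real). \<exists>n0 :: nat. \<forall>n \<ge> n0. \<forall>v \<ge> (1::nat). \<forall>U :: nat set.
    infinite U \<or> n ^ 3 \<le> card U \<longrightarrow>
    (\<exists>S :: operation list pmf. set_pmf S \<subseteq> op_sequences U n v \<and>
      (\<forall>M D. dynamic_retrieval U n v M D \<longrightarrow>
        ennreal (real n * real v + c * (real n * log 2 (log 2 (real n))))
          \<le> expected_size M D S))"
proof -
  let ?R = "\<lambda>n. 1 / 64 * (real n * log 2 (log 2 (real n)))"
  obtain n0 where n0: "\<And>n. n0 \<le> n \<Longrightarrow> forces_excess (n div 2) (?R n)"
    using eventually_forces_excess unfolding eventually_sequentially by blast
  have "\<exists>S. set_pmf S \<subseteq> op_sequences U n v \<and>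
      (\<forall>M D. dynamic_retrieval U n v M D \<longrightarrow> ennreal (real n * real v + ?R n) \<le> expected_size M D S)"
    if n: "max n0 32 \<le> n" and v: "1 \<le> v" and U: "infinite U \<or> n ^ 3 \<le> card U" for n v U
  proof -
    obtain key where "key_blocks (n div 2) (n - n div 2) (n\<^sup>2) v U key"
      by (rule key_blocks_exist[OF U, of v]) (use n v in auto)
    then interpret key_blocks "n div 2" "n - n div 2" "n\<^sup>2" v U key .
    have "n div 2 + (n - n div 2) = n" by simp
    then show ?thesis
      using set_hard_distribution expected_size_hard_distribution_ge[OF _ n0[of n]] n
      by (intro exI[of _ hard_distribution]) auto
  qed
  then show ?thesis
    by (intro exI[of _ "1 / 64"] conjI exI[of _ "max n0 32"]) auto
qed

end
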